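(* Let $f$ be a meromorphic function on $\mathbb{C}$ of finite order $\sigma=\sigma(f)<+\infty$, and let $\eta$ be a fixed non-zero complex number. Then for each $\varepsilon>0$, $$T\big(r,f(z+\eta)\big)=T(r,f)+O(r^{\sigma-1+\varepsilon})+O(\log r)\qquad (r\to\infty).$$
   Context: Meromorphic means meromorphic in the whole complex plane. For meromorphic $f$: $m(r,f)=\frac1{2\pi}\int_0^{2\pi}\log^+|f(re^{i\theta})|\,d\theta$; $n(t,f)$ is the number of poles of $f$ in $|z|\le t$, with multiplicity; $N(r,f)=\int_0^r\frac{n(t,f)-n(0,f)}{t}\,dt+n(0,f)\log r$; $T(r,f)=m(r,f)+N(r,f)$ is the Nevanlinna characteristic. $T(r,f(z+\eta))$ is the characteristic of the function $z\mapsto f(z+\eta)$. The order is $\sigma(f)=\limsup_{r\to\infty}\frac{\log^+T(r,f)}{\log r}$. *)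

theory Defs
  imports
    "HOL-Complex_Analysis.Complex_Analysis"
    "HOL-Library.Landau_Symbols"
begin

(* Defined as ln (max 1 x), so that log_plus x = 0 for every x \<le> 1, including x = 0. *)
definition log_plus :: "real \<Rightarrow> real" where
  "log_plus x = ln (max 1 x)"

(* Meromorphic functions are taken in the library's sense f meromorphic_on UNIV: the values of f
   on a discrete closed set (in particular at the poles) are arbitrary. They have no influence on
   the definitions below, since is_pole and zorder only see punctured neighbourhoods and a circle
   contains only finitely many exceptional points. *)

definition proximity :: "real \<Rightarrow> (complex \<Rightarrow> complex) \<Rightarrow> real" where
  "proximity r f =
     1 / (2 * pi) * integral {0..2 * pi} (\<lambda>\<theta>. log_plus (norm (f (of_real r * cis \<theta>))))"

definition pole_count :: "real \<Rightarrow> (complex \<Rightarrow> complex) \<Rightarrow> nat" where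
  "pole_count t f = (\<Sum>z | norm z \<le> t \<and> is_pole f z. nat (- zorder f z))"

(* The integrand vanishes near t = 0, so the convention x / 0 = 0 is harmless. *)
definition integrated_pole_count :: "real \<Rightarrow> (complex \<Rightarrow> complex) \<Rightarrow> real" where
  "integrated_pole_count r f =
     integral {0..r} (\<lambda>t. (real (pole_count t f) - real (pole_count 0 f)) / t)
       + real (pole_count 0 f) * ln r"

definition nevanlinna_char :: "real \<Rightarrow> (complex \<Rightarrow> complex) \<Rightarrow> real" where
  "nevanlinna_char r f = proximity r f + integrated_pole_count r f"

definition growth_order :: "(complex \<Rightarrow> complex) \<Rightarrow> ereal" where
  "growth_order f = Limsup at_top (\<lambda>r::real. ereal (log_plus (nevanlinna_char r f) / ln r))"

end

theory Submission
  imports Defs "HOL-Real_Asymp.Real_Asymp"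
begin

text \<open>
  Since \<open>log\<^sup>+ |u|\<close> is the mean of \<open>log |u - cis \<alpha>|\<close> over \<open>\<alpha>\<close>, Jensen's formula gives Cartan's identity:
  up to a constant, \<open>T(r, f(z + c))\<close> is the mean over \<open>\<alpha>\<close> of the counting functions of the solutions of
  \<open>f = cis \<alpha>\<close>, centred at \<open>c\<close>. So no estimate of the logarithmic difference \<open>f(z + \<eta>) / f(z)\<close> is needed:
  it suffices to move the centre in counting functions. A zero \<open>s\<close> contributes
  \<open>ln (max r |s - c|) - ln (max 1 |s - c|)\<close>, and replacing \<open>c = 0\<close> by \<open>c = \<eta>\<close> changes this by
  \<open>O(1 / max 1 |s|)\<close>, and not at all if \<open>|s| > r + |\<eta>|\<close>. The sum of \<open>1 / max 1 |s|\<close> over these zeros is at most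
  a constant times the sum of \<open>2\<^sup>-\<^sup>k (T(2\<^sup>k\<^sup>+\<^sup>2, f) - T(1, f))\<close> over \<open>2\<^sup>k \<le> r + |\<eta>|\<close>, after averaging over \<open>\<alpha>\<close>. As
  \<open>T(r, f) = O(r\<^sup>\<sigma>\<^sup>+\<^sup>\<epsilon>)\<close>, this is a geometric sum.
\<close>

subsection \<open>Integration over a circle\<close>

text \<open>Angles range over the same closed interval as in \<open>proximity\<close>, but as a
  finite measure, so that AE arguments and Fubini on the product of \<open>circ\<close> with itself
  are available.\<close>

definition circ :: "real measure" where
  "circ = restrict_space lborel {0..2 * pi}"

lemma space_circ [simp]: "space circ = {0..2 * pi}"
  by (simp add: circ_def space_restrict_space)

lemma measurable_circ_iff: "f \<in> measurable circ N \<longleftrightarrow> f \<in> measurable (restrict_space borel {0..2 * pi}) N"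
  unfolding circ_def using measurable_cong_sets[OF sets_restrict_space_cong[OF sets_lborel] refl] by blast

lemma borel_measurable_imp_circ [measurable (raw)]: "f \<in> borel_measurable borel \<Longrightarrow> f \<in> borel_measurable circ"
  by (simp add: measurable_circ_iff measurable_restrict_space1)

lemma borel_measurable_cis [measurable]: "cis \<in> borel_measurable borel"
  by (intro borel_measurable_continuous_onI continuous_on_cis continuous_on_id)

lemma finite_measure_circ: "finite_measure circ"
  by (rule finite_measureI) (simp add: circ_def emeasure_restrict_space space_restrict_space)

interpretation circ: finite_measure circ
  by (rule finite_measure_circ)

interpretation circ_pair: pair_sigma_finite circ circ ..

lemma measure_circ [simp]: "measure circ {0..2 * pi} = 2 * pi"
  by (simp add: circ_def measure_restrict_space)

lemma has_bochner_integral_circ_const: "has_bochner_integral circ (\<lambda>_. c) (2 * pi * (c::real))"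
  by (simp add: has_bochner_integral_iff)

lemma integrable_circ_iff:
  "integrable circ f \<longleftrightarrow> set_integrable lborel {0..2 * pi} (f :: real \<Rightarrow> real)"
  by (simp add: circ_def integrable_restrict_space set_integrable_def)

lemma integral_circ_eq:
  assumes "integrable circ (f :: real \<Rightarrow> real)"
  shows "integral\<^sup>L circ f = integral {0..2 * pi} f"
proof -
  have "integral\<^sup>L circ f = (LINT x:{0..2 * pi}|lborel. f x)"
    by (simp add: circ_def integral_restrict_space set_lebesgue_integral_def)
  thus ?thesis
    using set_borel_integral_eq_integral(2)[of "{0..2 * pi}" f] assms
    by (simp add: integrable_circ_iff)
qed

lemma has_bochner_integral_circ_continuous:
  assumes "continuous_on {0..2 * pi} f" "(f has_integral (I::real)) {0..2 * pi}"
  shows "has_bochner_integral circ f I"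
proof -
  have "integrable circ f"
    unfolding integrable_circ_iff by (rule borel_integrable_atLeastAtMost') fact
  with assms(2) show ?thesis
    by (simp add: has_bochner_integral_iff integral_circ_eq integral_unique)
qed

lemma AE_circ_countable:
  assumes "countable A"
  shows "AE \<theta> in circ. \<theta> \<notin> A"
proof -
  have "AE \<theta> in lborel. \<theta> \<notin> A"
    using countable_imp_null_set_lborel[OF assms] by (rule AE_not_in)
  thus ?thesis
    unfolding circ_def by (subst AE_restrict_space_iff) auto
qed

lemma finite_circle_preimage:
  assumes "r > 0"
  shows "finite {\<theta> \<in> {0..2 * pi}. of_real r * cis \<theta> + c = x}"
proof (rule finite_subset)
  \<comment> \<open>\<open>Arg2pi\<close> takes values in [0, 2 pi), so the endpoint
    \<open>2 * pi\<close>, which gives the same point as 0, has to be listed separately.\<close>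
  show "{\<theta> \<in> {0..2 * pi}. of_real r * cis \<theta> + c = x} \<subseteq> {Arg2pi (x - c), 2 * pi}"
  proof
    fix \<theta> assume "\<theta> \<in> {\<theta> \<in> {0..2 * pi}. of_real r * cis \<theta> + c = x}"
    thus "\<theta> \<in> {Arg2pi (x - c), 2 * pi}"
      using Arg2pi_unique[of r \<theta> "x - c"] assms by (cases "\<theta> = 2 * pi") (auto simp: cis_conv_exp)
  qed
qed auto

text \<open>Each exceptional point is hit by finitely many angles. This is how identities valid only
  off a sparse set are used under circle integrals.\<close>

lemma AE_circ_avoids:
  assumes "r > 0" "countable X"
  shows "AE \<theta> in circ. of_real r * cis \<theta> + c \<notin> X"
proof -
  have "AE \<theta> in circ. \<theta> \<notin> (\<Union>x\<in>X. {\<theta> \<in> {0..2 * pi}. of_real r * cis \<theta> + c = x})"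
    using assms finite_circle_preimage
    by (intro AE_circ_countable countable_UN) (auto intro: countable_finite)
  moreover have "AE \<theta> in circ. \<theta> \<in> {0..2 * pi}"
    using AE_space[of circ] by simp
  ultimately show ?thesis
    by eventually_elim auto
qed

section \<open>Mean values over circles\<close>

lemma circle_mean_holomorphic:
  assumes "g holomorphic_on cball c r" "r > 0"
  shows "has_bochner_integral circ (\<lambda>\<theta>. Re (g (of_real r * cis \<theta> + c))) (2 * pi * Re (g c))"
proof (rule has_bochner_integral_circ_continuous)
  have cont: "continuous_on (cball c r) g"
    using assms by (intro holomorphic_on_imp_continuous_on)
  show "continuous_on {0..2 * pi} (\<lambda>\<theta>. Re (g (of_real r * cis \<theta> + c)))"
    using assms
    by (intro continuous_intros continuous_on_compose2[OF cont] continuous_on_cis)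
       (auto simp: dist_norm norm_mult)
  \<comment> \<open>On the circle du / (u - c) = i d\<theta>, so Cauchy's formula at the centre is
    the mean value property; the factor i is cancelled below by multiplying with -i.\<close>
  have "((\<lambda>u. g u / (u - c)) has_contour_integral (2 * of_real pi * \<i> * g c)) (circlepath c r)"
    using assms by (intro Cauchy_integral_circlepath_simple) auto
  hence "((\<lambda>t. g (c + of_real r * cis t) * \<i>) has_integral (2 * of_real pi * \<i> * g c)) {0..2 * pi}"
    unfolding circlepath_def using assms(2)
    by (subst (asm) has_contour_integral_part_circlepath_iff) simp_all
  from has_integral_mult_right[OF this, of "-\<i>"]
  have "((\<lambda>t. g (of_real r * cis t + c)) has_integral (2 * of_real pi * g c)) {0..2 * pi}"
    by (simp add: algebra_simps)
  from has_integral_linear[OF this bounded_linear_Re]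
  show "((\<lambda>\<theta>. Re (g (of_real r * cis \<theta> + c))) has_integral 2 * pi * Re (g c)) {0..2 * pi}"
    by (simp add: o_def)
qed


text \<open>A zero-free function on a disc has a holomorphic logarithm g, and ln |G| = Re g
  satisfies the mean value property.\<close>

lemma circle_mean_ln_norm_holomorphic:
  assumes "G holomorphic_on ball a R" "\<And>z. z \<in> ball a R \<Longrightarrow> G z \<noteq> 0"
    and "cball c r \<subseteq> ball a R" "r > 0"
  shows "has_bochner_integral circ (\<lambda>\<theta>. ln (norm (G (of_real r * cis \<theta> + c)))) (2 * pi * ln (norm (G c)))"
proof -
  have "simply_connected (ball a R)"
    by (intro convex_imp_simply_connected convex_ball)
  then obtain g where g: "g holomorphic_on ball a R" "\<And>z. z \<in> ball a R \<Longrightarrow> G z = exp (g z)"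
    using assms(1,2) simply_connected_eq_holomorphic_log[of "ball a R"] open_ball by metis
  have *: "ln (norm (G z)) = Re (g z)" if "z \<in> cball c r" for z
    using g(2)[of z] assms(3) that by auto
  have "has_bochner_integral circ (\<lambda>\<theta>. Re (g (of_real r * cis \<theta> + c))) (2 * pi * Re (g c))"
    using g(1) assms(3,4) by (intro circle_mean_holomorphic) (auto intro: holomorphic_on_subset)
  also have "?this \<longleftrightarrow> ?thesis"
    using assms(4)
    by (intro has_bochner_integral_cong) (auto simp: * dist_norm norm_mult)
  finally show ?thesis .
qed

text \<open>If a lies outside the circle, z - a is zero-free on the disc; if a lies inside, it is
  reflected to the outside; if a lies on the circle, the integrand is singular and a is approached
  radially from inside by monotone convergence.\<close>

lemma circle_mean_ln_norm_diff:
  assumes "r > 0"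
  shows "has_bochner_integral circ (\<lambda>\<theta>. ln (norm (of_real r * cis \<theta> - a))) (2 * pi * ln (max r (norm a)))"
proof -
  have outside: "has_bochner_integral circ (\<lambda>\<theta>. ln (norm (of_real r * cis \<theta> - a))) (2 * pi * ln (norm a))"
    if "norm a > r" for a :: complex
  proof -
    have "(\<lambda>z. z - a) holomorphic_on ball 0 (norm a)"
      by (intro holomorphic_intros)
    moreover have "z - a \<noteq> 0" if "z \<in> ball 0 (norm a)" for z
      using that by auto
    ultimately show ?thesis
      using circle_mean_ln_norm_holomorphic[of "\<lambda>z. z - a" 0 "norm a" 0 r] that assms
      by (simp add: cball_subset_ball_iff)
  qed
  have inside: "has_bochner_integral circ (\<lambda>\<theta>. ln (norm (of_real r * cis \<theta> - a))) (2 * pi * ln r)"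
    if a: "norm a < r" for a :: complex
  proof -
    \<comment> \<open>For |z| = 1 the norm is unchanged on replacing r z - a by r - cnj a * z, which
      has no zero in the closed unit disc and takes the value r at 0.\<close>
    have reflect: "norm (of_real r - cnj a * cis \<theta>) = norm (of_real r * cis \<theta> - a)" for \<theta>
    proof -
      have "norm (of_real r - cnj a * cis \<theta>) = norm (cnj (of_real r - cnj a * cis \<theta>))"
        by (simp only: complex_mod_cnj)
      also have "\<dots> = norm (cis \<theta> * (of_real r - a * cis (-\<theta>)))"
        by (simp add: norm_mult cis_cnj)
      also have "cis \<theta> * (of_real r - a * cis (-\<theta>)) = of_real r * cis \<theta> - a"
        by (simp add: algebra_simps cis_mult)
      finally show ?thesis .
    qed
    \<comment> \<open>The mean value lemma needs a zero-free open disc that contains the closed unit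
      disc, hence a radius slightly above 1.\<close>
    obtain R where R: "1 < R" "norm a * R < r"
    proof -
      have "\<exists>R>1. norm a * R < r"
      proof (cases "a = 0")
        case False
        with a have "1 < r / norm a" by simp
        then obtain R where "1 < R" "R < r / norm a"
          using dense by blast
        with False show ?thesis by (auto simp: field_simps)
      qed (use assms in \<open>auto intro: exI[of _ 2]\<close>)
      thus ?thesis using that by blast
    qed
    have nz: "of_real r - cnj a * z \<noteq> 0" if "z \<in> ball 0 R" for z
    proof
      assume "of_real r - cnj a * z = 0"
      hence "norm (of_real r :: complex) = norm (cnj a * z)" by simp
      also have "\<dots> \<le> norm a * R"
        using that by (auto simp: norm_mult intro!: mult_left_mono)
      finally show False using R assms by simp
    qed
    have "has_bochner_integral circ (\<lambda>\<theta>. ln (norm (of_real r - cnj a * (of_real 1 * cis \<theta> + 0))))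
            (2 * pi * ln (norm (of_real r - cnj a * 0)))"
      using R(1) nz
      by (intro circle_mean_ln_norm_holomorphic[where a = 0 and R = R])
         (auto intro!: holomorphic_intros simp: cball_subset_ball_iff)
    thus ?thesis using assms by (simp add: reflect)
  qed
  consider "norm a < r" | "norm a > r" | "norm a = r" by linarith
  thus ?thesis
  proof cases
    case 3
    define t where "t = (\<lambda>n::nat. 1 - 1 / (real n + 2))"
    have t: "0 \<le> t n" "t n < 1" for n
      by (auto simp: t_def field_simps)
    have t_mono: "t m \<le> t n" if "m \<le> n" for m n
      using that by (auto simp: t_def field_simps)
    have t_lim: "t \<longlonglongrightarrow> 1"
      unfolding t_def by real_asymp
    have t_mult: "norm (of_real (t n) * a) < r" for n
      using 3 t[of n] assms by (simp add: norm_mult)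
    \<comment> \<open>The summand ln (1 + t) makes the sequence monotone: f is -ln q with q = |b - t
      a| / (1 + t), and q decreases as t increases to 1.\<close>
    define f where "f = (\<lambda>n \<theta>. ln (1 + t n) - ln (norm (of_real r * cis \<theta> - of_real (t n) * a)))"
    define u where "u = (\<lambda>\<theta>. ln 2 - ln (norm (of_real r * cis \<theta> - a)))"
    have ne: "AE \<theta> in circ. of_real r * cis \<theta> \<noteq> a"
      using AE_circ_avoids[OF assms, of "{a}" 0] by simp
    have f_int: "has_bochner_integral circ (f n) (2 * pi * (ln (1 + t n) - ln r))" for n
      using has_bochner_integral_diff[OF has_bochner_integral_circ_const inside[OF t_mult[of n]], of "ln (1 + t n)"]
      by (simp add: f_def right_diff_distrib)
    have "has_bochner_integral circ u (2 * pi * (ln (1 + 1) - ln r))"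
    proof (rule has_bochner_integral_monotone_convergence)
      show "integrable circ (f n)" for n
        using f_int[of n] by (simp add: has_bochner_integral_iff)
      show "AE \<theta> in circ. mono (\<lambda>n. f n \<theta>)"
        using ne
      proof eventually_elim
        case (elim \<theta>)
        define b where "b = of_real r * cis \<theta>"
        have b: "norm b = r" "norm a = r" using assms 3 by (auto simp: b_def norm_mult)
        have nz: "b - of_real (t n) * a \<noteq> 0" for n
          using t_mult[of n] b by auto
        have sq: "(norm (b - of_real s * a))\<^sup>2 = r\<^sup>2 * (1 + s)\<^sup>2 - 2 * s * (r\<^sup>2 + Re (b * cnj a))" for s :: real
        proof -
          have "(Re a)\<^sup>2 + (Im a)\<^sup>2 = r\<^sup>2" "(Re b)\<^sup>2 + (Im b)\<^sup>2 = r\<^sup>2"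
            by (simp_all add: b flip: cmod_power2)
          thus ?thesis
            unfolding cmod_power2 by simp algebra
        qed
        define q where "q = (\<lambda>n. norm (b - of_real (t n) * a) / (1 + t n))"
        have q_pos: "q n > 0" for n
          using nz[of n] t[of n] by (auto simp: q_def)
        have kappa: "r\<^sup>2 + Re (b * cnj a) \<ge> 0"
        proof -
          have "\<bar>Re (b * cnj a)\<bar> \<le> norm (b * cnj a)" by (rule abs_Re_le_cmod)
          also have "\<dots> = r\<^sup>2" using b by (simp add: norm_mult power2_eq_square)
          finally show ?thesis by simp
        qed
        have q_sq: "(q n)\<^sup>2 = r\<^sup>2 - 2 * (t n / (1 + t n)\<^sup>2) * (r\<^sup>2 + Re (b * cnj a))" for n
        proof -
          have "1 + t n \<noteq> 0" using t[of n] by simp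
          thus ?thesis by (simp add: q_def power_divide sq diff_divide_distrib)
        qed
        have "q n \<le> q m" if "m \<le> n" for m n
        proof (rule power2_le_imp_le)
          \<comment> \<open>Only the coefficient t / (1 + t)^2 in the formula for q^2 depends on n.
            It increases on [0, 1], because the cross-multiplied difference factors as (t n - t m)
            (1 - t m t n).\<close>
          have "t m / (1 + t m)\<^sup>2 \<le> t n / (1 + t n)\<^sup>2"
          proof -
            have "0 \<le> (t n - t m) * (1 - t m * t n)"
              using t[of m] t[of n] t_mono[OF that]
              by (intro mult_nonneg_nonneg) (auto simp: mult_le_one)
            hence "t m * (1 + t n)\<^sup>2 \<le> t n * (1 + t m)\<^sup>2"
              by (simp add: power2_eq_square algebra_simps)
            thus ?thesis using t[of m] t[of n] by (simp add: frac_le_eq divide_simps)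
          qed
          hence "t m / (1 + t m)\<^sup>2 * (r\<^sup>2 + Re (b * cnj a)) \<le> t n / (1 + t n)\<^sup>2 * (r\<^sup>2 + Re (b * cnj a))"
            using kappa by (rule mult_right_mono)
          thus "(q n)\<^sup>2 \<le> (q m)\<^sup>2"
            unfolding q_sq by linarith
        qed (use q_pos[of m] in simp)
        moreover have "f n \<theta> = - ln (q n)" for n
          using nz[of n] t[of n] by (simp add: f_def q_def b_def ln_div)
        ultimately show ?case
          using q_pos by (auto simp: mono_def)
      qed
      show "AE \<theta> in circ. (\<lambda>n. f n \<theta>) \<longlonglongrightarrow> u \<theta>"
        using ne
      proof eventually_elim
        case (elim \<theta>)
        have "(\<lambda>n. f n \<theta>) \<longlonglongrightarrow> ln (1 + 1) - ln (norm (of_real r * cis \<theta> - of_real 1 * a))"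
          unfolding f_def using elim by (intro tendsto_intros t_lim) auto
        thus ?case by (simp add: u_def)
      qed
      have "(\<lambda>n. 2 * pi * (ln (1 + t n) - ln r)) \<longlonglongrightarrow> 2 * pi * (ln (1 + 1) - ln r)"
        by (intro tendsto_intros t_lim) auto
      thus "(\<lambda>n. integral\<^sup>L circ (f n)) \<longlonglongrightarrow> 2 * pi * (ln (1 + 1) - ln r)"
        using f_int by (simp add: has_bochner_integral_iff)
      have "(\<lambda>\<theta>. ln 2 - ln (norm (of_real r * cis \<theta> - a))) \<in> borel_measurable borel"
        by measurable
      thus "u \<in> borel_measurable circ"
        unfolding u_def by (rule borel_measurable_imp_circ)
    qed
    from has_bochner_integral_diff[OF has_bochner_integral_circ_const this, of "ln 2"]
    show ?thesis using 3 by (simp add: u_def right_diff_distrib)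
  qed (use inside outside in \<open>auto simp: max_def\<close>)
qed

subsection \<open>Jensen's formula\<close>

lemma zorder_ne_0_iff:
  assumes "h meromorphic_on {z}" "eventually (\<lambda>w. h w \<noteq> 0) (at z)"
  shows "zorder h z > 0 \<longleftrightarrow> isolated_zero h z" and "zorder h z < 0 \<longleftrightarrow> is_pole h z"
proof -
  have sing: "isolated_singularity_at h z"
    using assms(1) by (simp add: meromorphic_at_iff)
  show "zorder h z > 0 \<longleftrightarrow> isolated_zero h z"
    using zorder_pos_imp_isolated_zero[OF assms] zorder_isolated_zero_pos' sing by blast
  show "zorder h z < 0 \<longleftrightarrow> is_pole h z"
    using zorder_neg_imp_is_pole[OF assms] isolated_pole_imp_neg_zorder sing by blast
qed

lemma eventually_cosparse_UNIV_at: "eventually P (cosparse UNIV) \<Longrightarrow> eventually P (at (z::complex))"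
  by (simp add: eventually_cosparse_open_eq)

lemma finite_zeros_and_poles:
  assumes "h meromorphic_on UNIV" "\<forall>\<^sub>\<approx>z\<in>UNIV. h z \<noteq> 0" "compact K"
  shows "finite {z \<in> K. zorder h z \<noteq> 0}"
proof -
  have "\<forall>\<^sub>\<approx>z\<in>UNIV. zorder h z = 0"
    using meromorphic_on_imp_not_pole_cosparse[OF assms(1)] meromorphic_on_imp_not_zero_cosparse[OF assms(1)]
  proof eventually_elim
    case (elim z)
    moreover have "h meromorphic_on {z}" "eventually (\<lambda>w. h w \<noteq> 0) (at z)"
      using assms meromorphic_on_subset[of h UNIV "{z}"] eventually_cosparse_UNIV_at by auto
    ultimately show ?case
      using zorder_ne_0_iff[of h z] by linarith
  qed
  hence "{z. zorder h z \<noteq> 0} sparse_in K"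
    by (auto simp: eventually_cosparse intro: sparse_in_subset)
  from sparse_in_compact_finite[OF this assms(3)] show ?thesis
    by (simp add: Int_def)
qed

lemma finite_poles:
  assumes "f meromorphic_on UNIV" "compact K"
  shows "finite {z \<in> K. is_pole f z}"
proof -
  have "{z. is_pole f z} sparse_in K"
    using meromorphic_on_imp_not_pole_cosparse[OF assms(1)]
    by (auto simp: eventually_cosparse intro: sparse_in_subset)
  from sparse_in_compact_finite[OF this assms(2)] show ?thesis
    by (simp add: Int_def)
qed

lemma zorder_power_int_diff:
  "zorder (\<lambda>z. (z - s) powi n) z = (if z = s then n else 0)" for z s :: complex
proof -
  have "zorder (\<lambda>z. (z - s) powi n) z = n * zorder (\<lambda>z. z - s) z"
    using eventually_neq_at_within[of s z UNIV]
    by (intro zorder_power_int meromorphic_intros eventually_frequently) auto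
  moreover have "zorder (\<lambda>z. z - s) s = 1"
    by (rule zorder_eqI[of UNIV _ "\<lambda>_. 1"]) auto
  moreover have "zorder (\<lambda>z. z - s) z = 0" if "z \<noteq> s"
    using that by (intro zorder_eq_0I) (auto intro!: analytic_intros)
  ultimately show ?thesis by auto
qed

text \<open>A meromorphic function is arbitrary on a sparse set, so the factorization can only hold off one.\<close>

lemma meromorphic_factorization_cball:
  fixes R :: real
  assumes "h meromorphic_on UNIV" "\<forall>\<^sub>\<approx>z\<in>UNIV. h z \<noteq> 0"
  defines "S \<equiv> {z \<in> cball 0 R. zorder h z \<noteq> 0}"
  obtains G where "G holomorphic_on ball 0 R" "\<And>z. z \<in> ball 0 R \<Longrightarrow> G z \<noteq> 0"
    "\<forall>\<^sub>\<approx>z\<in>UNIV. h z = G z * (\<Prod>s\<in>S. (z - s) powi zorder h s)"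
proof -
  have fin: "finite S"
    unfolding S_def by (intro finite_zeros_and_poles assms compact_cball)
  define P where "P = (\<lambda>z. \<Prod>s\<in>S. (z - s) powi zorder h s)"
  \<comment> \<open>Dividing out all zeros and poles leaves order 0 throughout the open disc, so the
    remaining singularities are removable and \<open>remove_sings\<close> yields a zero-free
    holomorphic factor.\<close>
  define Q where "Q = (\<lambda>z. h z / P z)"
  have h_mero: "h meromorphic_on A" for A
    using assms(1) by (rule meromorphic_on_subset) auto
  have P_mero: "P meromorphic_on A" for A
    unfolding P_def by (intro meromorphic_intros)
  have Q_mero: "Q meromorphic_on A" for A
    unfolding Q_def by (intro meromorphic_intros h_mero P_mero)
  have "finite {z. P z = 0}"
    by (rule finite_subset[OF _ fin]) (auto simp: P_def fin)
  hence P_nz: "\<forall>\<^sub>\<approx>z\<in>UNIV. P z \<noteq> 0"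
    by (auto simp: eventually_cosparse intro!: finite_imp_sparse)
  have P_zorder: "zorder P z = (if z \<in> S then zorder h z else 0)" for z
  proof -
    have "zorder P z = (\<Sum>s\<in>S. zorder (\<lambda>z. (z - s) powi zorder h s) z)"
      using eventually_cosparse_UNIV_at[OF P_nz]
      unfolding P_def by (intro zorder_prod) (auto intro!: meromorphic_intros)
    also have "\<dots> = (if z \<in> S then zorder h z else 0)"
      using fin by (simp add: zorder_power_int_diff)
    finally show ?thesis .
  qed
  have Q_nz: "\<forall>\<^sub>\<approx>z\<in>UNIV. Q z \<noteq> 0"
    using P_nz assms(2) unfolding Q_def by eventually_elim auto
  have Q_zorder: "zorder Q z = 0" if "z \<in> ball 0 R" for z
  proof -
    have "zorder Q z = zorder h z - zorder P z"
      unfolding Q_def using eventually_cosparse_UNIV_at[OF P_nz] eventually_cosparse_UNIV_at[OF assms(2)]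
      by (intro zorder_divide h_mero P_mero eventually_frequently) auto
    thus ?thesis using that by (auto simp: P_zorder S_def)
  qed
  define G where "G = remove_sings Q"
  show ?thesis
  proof (rule that[of G])
    have *: "G analytic_on {z} \<and> G z \<noteq> 0" if "z \<in> ball 0 R" for z
    proof -
      have "\<not>is_pole Q z" "\<not>isolated_zero Q z"
        using zorder_ne_0_iff[OF Q_mero eventually_cosparse_UNIV_at[OF Q_nz], of z] Q_zorder[OF that]
        by auto
      moreover have Q: "isolated_singularity_at Q z" "not_essential Q z"
        using Q_mero[of "{z}"] by (auto simp: meromorphic_at_iff)
      moreover have "eventually (\<lambda>w. Q w \<noteq> 0) (at z)"
        by (intro eventually_cosparse_UNIV_at Q_nz)
      ultimately show ?thesis
        unfolding G_def not_essential_def isolated_zero_def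
        using remove_sings_analytic_at[of Q z] remove_sings_eq_0_iff[of Q z] by blast
    qed
    show "G holomorphic_on ball 0 R"
      using * by (intro analytic_imp_holomorphic) (subst analytic_on_analytic_at, auto)
    show "G z \<noteq> 0" if "z \<in> ball 0 R" for z
      using *[OF that] by blast
    show "\<forall>\<^sub>\<approx>z\<in>UNIV. h z = G z * (\<Prod>s\<in>S. (z - s) powi zorder h s)"
      using P_nz eventually_remove_sings_eq[OF Q_mero[of UNIV]]
      unfolding G_def by eventually_elim (simp add: Q_def P_def)
  qed
qed

lemma ln_power_int:
  fixes x :: real
  assumes "x > 0"
  shows "ln (x powi n) = n * ln x"
  using assms by (cases n rule: int_cases2) (simp_all add: ln_realpow power_int_minus ln_inverse)

lemma AE_circ_cosparse:
  assumes "r > 0" "eventually P (cosparse UNIV)"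
  shows "AE \<theta> in circ. P (of_real r * cis \<theta> + c)"
  using AE_circ_avoids[OF assms(1) sparse_imp_countable, of UNIV "{z. \<not>P z}" c] assms(2)
  by (simp add: eventually_cosparse)

text \<open>The arbitrary values do no harm: the points where f is not analytic form a countable
  set, and f is continuous off it.\<close>

lemma meromorphic_borel_measurable:
  assumes "f meromorphic_on UNIV"
  shows "f \<in> borel_measurable borel"
proof -
  define X where "X = {z. \<not>f analytic_on {z}}"
  have "X sparse_in UNIV"
    unfolding X_def by (rule meromorphic_on_imp_sparse_singularities[OF assms])
  hence "countable X"
    using sparse_imp_countable[of UNIV X] by simp
  moreover have "f analytic_on - X"
    by (subst analytic_on_analytic_at) (auto simp: X_def)
  hence "continuous_on (- X) f"
    by (intro holomorphic_on_imp_continuous_on analytic_imp_holomorphic)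
  ultimately show ?thesis
    by (rule borel_measurable_continuous_countable_exceptions)
qed

text \<open>Integrate the logarithm of the factorization factor by factor. The form matters later:
  \<open>a c\<close> may depend on the centre but not on r, so it drops out of differences in r, and
  one index set serves all circles inside the disc of radius R.\<close>

theorem jensen:
  assumes "h meromorphic_on UNIV" "\<forall>\<^sub>\<approx>z\<in>UNIV. h z \<noteq> 0"
  obtains a :: "complex \<Rightarrow> real" where
    "\<And>c r. r > 0 \<Longrightarrow> norm c + r < R \<Longrightarrow>
       has_bochner_integral circ (\<lambda>\<theta>. ln (norm (h (of_real r * cis \<theta> + c))))
         (2 * pi * (a c + (\<Sum>s | s \<in> cball 0 R \<and> zorder h s \<noteq> 0. zorder h s * ln (max r (norm (s - c))))))"
proof -
  define S where "S = {s. s \<in> cball 0 R \<and> zorder h s \<noteq> 0}"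
  have fin: "finite S"
    unfolding S_def by (rule finite_zeros_and_poles[OF assms compact_cball])
  obtain G where G: "G holomorphic_on ball 0 R" "\<And>z. z \<in> ball 0 R \<Longrightarrow> G z \<noteq> 0"
    "\<forall>\<^sub>\<approx>z\<in>UNIV. h z = G z * (\<Prod>s\<in>S. (z - s) powi zorder h s)"
    using meromorphic_factorization_cball[OF assms, of R] unfolding S_def by blast
  have [measurable]: "h \<in> borel_measurable borel"
    by (intro meromorphic_borel_measurable assms)
  have "has_bochner_integral circ (\<lambda>\<theta>. ln (norm (h (of_real r * cis \<theta> + c))))
          (2 * pi * (ln (norm (G c)) + (\<Sum>s\<in>S. zorder h s * ln (max r (norm (s - c))))))"
    if r: "r > 0" "norm c + r < R" for c r
  proof -
    have sub: "cball c r \<subseteq> ball 0 R"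
      using r by (auto simp: cball_subset_ball_iff)
    have "has_bochner_integral circ (\<lambda>\<theta>. ln (norm (G (of_real r * cis \<theta> + c))) +
            (\<Sum>s\<in>S. zorder h s * ln (norm (of_real r * cis \<theta> - (s - c)))))
          (2 * pi * ln (norm (G c)) + (\<Sum>s\<in>S. zorder h s * (2 * pi * ln (max r (norm (s - c))))))"
      using circle_mean_ln_norm_holomorphic[OF G(1,2) sub r(1)] circle_mean_ln_norm_diff[OF r(1)]
      by (intro has_bochner_integral_add has_bochner_integral_sum has_bochner_integral_mult_right) auto
    also have "2 * pi * ln (norm (G c)) + (\<Sum>s\<in>S. zorder h s * (2 * pi * ln (max r (norm (s - c))))) =
          2 * pi * (ln (norm (G c)) + (\<Sum>s\<in>S. zorder h s * ln (max r (norm (s - c)))))"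
      by (simp add: algebra_simps sum_distrib_left)
    also have "has_bochner_integral circ (\<lambda>\<theta>. ln (norm (G (of_real r * cis \<theta> + c))) +
            (\<Sum>s\<in>S. zorder h s * ln (norm (of_real r * cis \<theta> - (s - c))))) = 
          has_bochner_integral circ (\<lambda>\<theta>. ln (norm (h (of_real r * cis \<theta> + c))))"
    proof (intro ext has_bochner_integral_cong_AE)
      show "(\<lambda>\<theta>. ln (norm (h (of_real r * cis \<theta> + c)))) \<in> borel_measurable circ"
        by (intro borel_measurable_imp_circ) measurable
      show "(\<lambda>\<theta>. ln (norm (G (of_real r * cis \<theta> + c))) +
            (\<Sum>s\<in>S. zorder h s * ln (norm (of_real r * cis \<theta> - (s - c))))) \<in> borel_measurable circ"
        using circle_mean_ln_norm_holomorphic[OF G(1,2) sub r(1)]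
        by (intro borel_measurable_add borel_measurable_imp_circ[of "\<lambda>\<theta>. \<Sum>s\<in>S. _ s \<theta>"])
           (auto simp: has_bochner_integral_iff)
      have "AE \<theta> in circ. \<theta> \<in> {0..2 * pi}"
        using AE_space[of circ] by simp
      \<comment> \<open>A circle may pass through zeros or poles; there the logarithm of the product
        does not split, as ln 0 = 0.\<close>
      moreover have "AE \<theta> in circ. of_real r * cis \<theta> + c \<notin> S"
        by (intro AE_circ_avoids r countable_finite fin)
      moreover note AE_circ_cosparse[OF r(1) G(3), of c]
      ultimately show "AE \<theta> in circ. ln (norm (G (of_real r * cis \<theta> + c))) +
            (\<Sum>s\<in>S. zorder h s * ln (norm (of_real r * cis \<theta> - (s - c)))) =
            ln (norm (h (of_real r * cis \<theta> + c)))"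
      proof eventually_elim
        case (elim \<theta>)
        define z where "z = of_real r * cis \<theta> + c"
        have "z \<in> ball 0 R"
          using norm_triangle_ineq[of "of_real r * cis \<theta>" c] r by (simp add: z_def norm_mult)
        hence "ln (norm (h z)) = ln (norm (G z)) + (\<Sum>s\<in>S. ln (norm ((z - s) powi zorder h s)))"
          using elim(2,3) G(2)[of z] fin
          by (simp add: z_def norm_mult ln_mult flip: prod_norm) (subst ln_prod, auto)
        also have "(\<Sum>s\<in>S. ln (norm ((z - s) powi zorder h s))) = (\<Sum>s\<in>S. zorder h s * ln (norm (z - s)))"
          using elim(2) by (intro sum.cong refl, subst norm_power_int, subst ln_power_int) (auto simp: z_def)
        finally show ?case by (simp add: z_def algebra_simps)
      qed
    qed
    finally show ?thesis .
  qed
  thus ?thesis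
    using that[of "\<lambda>c. ln (norm (G c))"] unfolding S_def by blast
qed

subsection \<open>Counting functions under translation\<close>

lemma abs_ln_diff_le:
  fixes a b :: real
  assumes "a > 0" "b > 0"
  shows "\<bar>ln a - ln b\<bar> \<le> \<bar>a - b\<bar> / min a b"
proof -
  have *: "ln x - ln y \<le> \<bar>x - y\<bar> / min x y" "ln y - ln x \<le> \<bar>x - y\<bar> / min x y"
    if "y \<le> x" "y > 0" for x y :: real
  proof -
    show "ln x - ln y \<le> \<bar>x - y\<bar> / min x y"
      using that ln_diff_le[of x y] by (simp add: min_def)
    have "ln y - ln x \<le> 0" using that by simp
    also have "0 \<le> \<bar>x - y\<bar> / min x y" using that by simp
    finally show "ln y - ln x \<le> \<bar>x - y\<bar> / min x y" .
  qed
  show ?thesis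
  proof (cases "b \<le> a")
    case True
    thus ?thesis using *[of b a] assms by linarith
  next
    case False
    thus ?thesis using *[of a b] assms by (simp add: abs_minus_commute min.commute)
  qed
qed

text \<open>\<open>green r z\<close> is the contribution of a zero at \<open>z\<close> to the integral of \<open>n(t) / t\<close> over \<open>[1, r]\<close>.\<close>

definition green :: "real \<Rightarrow> complex \<Rightarrow> real" where
  "green r z = ln (max r (norm z)) - ln (max 1 (norm z))"

lemma green_nonneg: "r \<ge> 1 \<Longrightarrow> green r z \<ge> 0"
  by (auto simp: green_def)

text \<open>In this form z enters only through the truncation of |z| to [1, r], which is a
  1-Lipschitz function of |z|.\<close>

lemma green_eq:
  assumes "r \<ge> 1"
  shows "green r z = ln r - ln (max 1 (min r (norm z)))"
  using assms by (auto simp: green_def max_def min_def)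

text \<open>
  Apply \<open>|ln a - ln b| \<le> |a - b| / min a b\<close> to the truncations of \<open>|s - \<eta>|\<close> and \<open>|s|\<close> to \<open>[1, r]\<close>,
  both of which are at least \<open>|s|\<close> up to a constant factor when \<open>|s| \<le> r + |\<eta>|\<close>.
\<close>

lemma green_diff_le:
  assumes r: "r \<ge> 1"
  shows "\<bar>green r (s - \<eta>) - green r s\<bar> \<le>
    (if norm s \<le> r + norm \<eta> then norm \<eta> * (1 + norm \<eta>)\<^sup>2 / max 1 (norm s) else 0)"
proof (cases "norm s \<le> r + norm \<eta>")
  case False
  \<comment> \<open>Seen from either centre, s lies at distance at least r, so both contributions
    vanish.\<close>
  hence "norm (s - \<eta>) \<ge> r" "norm s \<ge> r"
    using norm_triangle_ineq2[of s \<eta>] norm_ge_zero[of \<eta>] by linarith+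
  with False r show ?thesis by (simp add: green_def max_absorb2)
next
  case True
  define d where "d = norm \<eta>"
  define a where "a = max 1 (min r (norm (s - \<eta>)))"
  define b where "b = max 1 (min r (norm s))"
  have d: "d \<ge> 0" by (simp add: d_def)
  have ab: "a \<ge> 1" "b \<ge> 1" by (auto simp: a_def b_def)
  have "\<bar>norm (s - \<eta>) - norm s\<bar> \<le> d"
    using norm_triangle_ineq3[of "s - \<eta>" s] by (simp add: d_def)
  hence diff: "\<bar>a - b\<bar> \<le> d"
    using d by (auto simp: a_def b_def max_def min_def)
  have le_b: "max 1 (norm s) \<le> (1 + d) * b"
  proof (cases "norm s \<le> r")
    case True
    hence "max 1 (norm s) = b" by (auto simp: b_def)
    thus ?thesis using mult_right_mono[of 1 "1 + d" b] d ab by simp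
  next
    case False
    hence "b = r" using r by (auto simp: b_def)
    moreover have "max 1 (norm s) \<le> r + d" using True False r by (auto simp: d_def)
    moreover have "d \<le> d * r" using mult_left_mono[OF r d] by simp
    ultimately show ?thesis by (simp add: algebra_simps)
  qed
  \<comment> \<open>Comparing |s| with b cost one factor 1 + d, since b may be cut off at r; passing
    to the smaller of the two truncations costs another. Hence the square in the constant.\<close>
  have le_min: "b \<le> (1 + d) * min a b"
  proof -
    have "b \<le> a + d * 1" using diff by simp
    also have "\<dots> \<le> a + d * a" using ab d by (intro add_left_mono mult_left_mono) auto
    finally have "b \<le> (1 + d) * a" by (simp add: algebra_simps)
    moreover have "b \<le> (1 + d) * b" using mult_right_mono[of 1 "1 + d" b] d ab by simp
    ultimately show ?thesis by (simp add: min_def)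
  qed
  have "max 1 (norm s) \<le> (1 + d) * ((1 + d) * min a b)"
    using le_b mult_left_mono[OF le_min, of "1 + d"] d by linarith
  hence le: "max 1 (norm s) \<le> (1 + d)\<^sup>2 * min a b"
    by (simp add: power2_eq_square mult.assoc)
  have "\<bar>green r (s - \<eta>) - green r s\<bar> = \<bar>ln a - ln b\<bar>"
    using r by (simp add: green_eq a_def b_def abs_minus_commute)
  also have "\<dots> \<le> \<bar>a - b\<bar> / min a b"
    using ab by (intro abs_ln_diff_le) auto
  also have "\<dots> \<le> d / min a b"
    using diff ab by (intro divide_right_mono) auto
  also have "\<dots> \<le> d * (1 + d)\<^sup>2 / max 1 (norm s)"
    using mult_left_mono[OF le d] ab by (simp add: field_simps)
  finally show ?thesis using True by (simp add: d_def)
qed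

section \<open>Dyadic majorant for the effect of moving the centre\<close>

lemma dyadic_green_nonneg: "green (2 ^ k) s \<ge> 0"
  by (intro green_nonneg one_le_power) simp

lemma ex_dyadic_interval:
  fixes m :: real
  assumes "1 \<le> m" "m < 2 ^ Suc K"
  shows "\<exists>k\<le>K. 2 ^ k \<le> m \<and> m < 2 ^ Suc k"
  using assms
proof (induction K)
  case (Suc K)
  show ?case
  proof (cases "m < 2 ^ Suc K")
    case True
    thus ?thesis using Suc by (meson le_SucI)
  next
    case False
    thus ?thesis using Suc.prems by (intro exI[of _ "Suc K"]) auto
  qed
qed auto

text \<open>A single term suffices: if 2^k <= max 1 |s| < 2^(k+1), then the radius 2^(k+2) exceeds
  max 1 |s| by more than a factor 2, so that its \<open>green\<close> value is at least ln 2. The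
  shift by 2 in the exponent secures this factor.\<close>

lemma inverse_le_dyadic_green:
  assumes "norm s < 2 ^ Suc K"
  shows "1 / max 1 (norm s) \<le> (\<Sum>k\<le>K. green (2 ^ (k + 2)) s / 2 ^ k) / ln 2"
proof -
  define m where "m = max 1 (norm s)"
  have m: "1 \<le> m" "m < 2 ^ Suc K"
    using assms by (auto simp: m_def simp del: power_Suc intro!: one_less_power)
  then obtain k where k: "k \<le> K" "2 ^ k \<le> m" "m < 2 ^ Suc k"
    using ex_dyadic_interval by blast
  have "ln 2 / m \<le> ln 2 / 2 ^ k"
    using k m by (intro divide_left_mono) auto
  also have "\<dots> \<le> green (2 ^ (k + 2)) s / 2 ^ k"
  proof (intro divide_right_mono)
    have "m \<le> 2 ^ (k + 2)" using k by simp
    hence "norm s \<le> 2 ^ (k + 2)" by (simp add: m_def)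
    hence "green (2 ^ (k + 2)) s = ln (2 ^ (k + 2)) - ln m"
      by (simp add: green_def m_def max_def)
    also have "\<dots> \<ge> ln (2 ^ (k + 2)) - ln (2 ^ Suc k)"
      using k m by (intro diff_left_mono) (auto simp del: power_Suc)
    also have "ln (2 ^ (k + 2)) - ln (2 ^ Suc k) = (ln 2 :: real)"
      using ln_realpow[of "2::real" "k + 2"] ln_realpow[of "2::real" "Suc k"]
      by (simp only:) (simp add: algebra_simps)
    finally show "ln 2 \<le> green (2 ^ (k + 2)) s" .
  qed auto
  also have "\<dots> \<le> (\<Sum>k\<le>K. green (2 ^ (k + 2)) s / 2 ^ k)"
    using k by (intro member_le_sum[of k] divide_nonneg_nonneg dyadic_green_nonneg) auto
  finally show ?thesis by (simp add: m_def field_simps)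
qed

text \<open>The coefficients on the right do not depend on s, so summing over zeros turns the bound
  into one by counting functions at dyadic radii.\<close>

lemma green_diff_le_dyadic:
  assumes "r \<ge> 1" "r + norm \<eta> < 2 ^ Suc K"
  shows "\<bar>green r (s - \<eta>) - green r s\<bar> \<le>
    norm \<eta> * (1 + norm \<eta>)\<^sup>2 / ln 2 * (\<Sum>k\<le>K. green (2 ^ (k + 2)) s / 2 ^ k)"
proof (cases "norm s \<le> r + norm \<eta>")
  case True
  have "\<bar>green r (s - \<eta>) - green r s\<bar> \<le> norm \<eta> * (1 + norm \<eta>)\<^sup>2 * (1 / max 1 (norm s))"
    using green_diff_le[OF assms(1), of s \<eta>] True by simp
  also have "\<dots> \<le> norm \<eta> * (1 + norm \<eta>)\<^sup>2 * ((\<Sum>k\<le>K. green (2 ^ (k + 2)) s / 2 ^ k) / ln 2)"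
    using True assms by (intro mult_left_mono inverse_le_dyadic_green) auto
  finally show ?thesis by simp
next
  case False
  have "0 \<le> (\<Sum>k\<le>K. green (2 ^ (k + 2)) s / 2 ^ k)"
    by (intro sum_nonneg divide_nonneg_nonneg dyadic_green_nonneg) auto
  hence "0 \<le> norm \<eta> * (1 + norm \<eta>)\<^sup>2 / ln 2 * (\<Sum>k\<le>K. green (2 ^ (k + 2)) s / 2 ^ k)"
    by (intro mult_nonneg_nonneg divide_nonneg_nonneg) auto
  thus ?thesis using green_diff_le[OF assms(1), of s \<eta>] False by simp
qed

text \<open>
  This is the closed form of \<open>N(r, f(z + c))\<close>. For \<open>p = c\<close> the convention \<open>ln 0 = 0\<close> turns the summand
  into \<open>ln r\<close> times the multiplicity (for \<open>r > 0\<close>), which is the term \<open>n(0) ln r\<close>.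
\<close>

definition pole_green :: "(complex \<Rightarrow> complex) \<Rightarrow> complex set \<Rightarrow> complex \<Rightarrow> real \<Rightarrow> real" where
  "pole_green f P c r = (\<Sum>p\<in>P. real (nat (- zorder f p)) * (ln (max r (norm (p - c))) - ln (norm (p - c))))"

section \<open>Counting the poles of a translate\<close>

lemma is_pole_translate_iff: "is_pole (\<lambda>z. f (z + c)) z \<longleftrightarrow> is_pole f (z + c)" for c z :: complex
  using is_pole_shift_iff[of f c] by (simp add: o_def add_ac)

lemma zorder_shift_eq: "zorder (\<lambda>z. f (z + c)) z = zorder f (z + c)"
  by (subst zorder_shift, subst (2) zorder_shift) (simp add: add_ac)

text \<open>The index set is independent of t, so n(t) / t can be integrated termwise over a fixed
  finite set of poles.\<close>

lemma pole_count_shift: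
  assumes "f meromorphic_on UNIV" "norm c + t \<le> R"
  shows "pole_count t (\<lambda>z. f (z + c)) =
    (\<Sum>p | p \<in> cball 0 R \<and> is_pole f p. if norm (p - c) \<le> t then nat (- zorder f p) else 0)"
proof -
  have fin: "finite {p \<in> cball 0 R. is_pole f p}"
    by (intro finite_poles assms compact_cball)
  have "pole_count t (\<lambda>z. f (z + c)) = (\<Sum>p | norm (p - c) \<le> t \<and> is_pole f p. nat (- zorder f p))"
    unfolding pole_count_def
    by (rule sum.reindex_bij_witness[of _ "\<lambda>p. p - c" "\<lambda>z. z + c"]) (auto simp: is_pole_translate_iff zorder_shift_eq)
  also have "\<dots> = (\<Sum>p | p \<in> cball 0 R \<and> is_pole f p. if norm (p - c) \<le> t then nat (- zorder f p) else 0)"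
  proof -
    have "norm p \<le> R" if "norm (p - c) \<le> t" for p
      using norm_triangle_ineq[of "p - c" c] that assms(2) by simp
    hence "{p. norm (p - c) \<le> t \<and> is_pole f p} = {p \<in> cball 0 R. is_pole f p} \<inter> {p. norm (p - c) \<le> t}"
      by auto
    thus ?thesis using fin by (simp add: sum.inter_restrict)
  qed
  finally show ?thesis .
qed

text \<open>Contribution of one pole at distance \<rho> from the centre. For \<rho> = 0 the
  integrand vanishes, since such a pole is counted by n(0) ln r instead.\<close>

lemma has_integral_pole_kernel:
  fixes r \<rho> :: real
  assumes "\<rho> \<ge> 0" "r > 0"
  shows "((\<lambda>t. ((if \<rho> \<le> t then 1 else 0) - (if \<rho> \<le> 0 then 1 else 0)) / t) has_integral
    (if \<rho> = 0 then 0 else ln (max r \<rho>) - ln \<rho>)) {0..r}"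
proof (cases "\<rho> = 0")
  case True
  have "((\<lambda>t. 0) has_integral (0::real)) {0..r}" by simp
  thus ?thesis using True by (subst has_integral_cong[where g = "\<lambda>_. 0"]) auto
next
  case False
  hence pos: "\<rho> > 0" using assms by simp
  show ?thesis
  proof (cases "\<rho> \<le> r")
    case True
    have "((\<lambda>t. 1 / t) has_integral (ln r - ln \<rho>)) {\<rho>..r}"
      using pos True by (intro fundamental_theorem_of_calculus)
        (auto intro!: derivative_eq_intros simp: has_real_derivative_iff_has_vector_derivative[symmetric])
    hence "((\<lambda>t. if t \<in> {\<rho>..r} then 1 / t else 0) has_integral (ln r - ln \<rho>)) {0..r}"
      using pos by (subst has_integral_restrict) auto
    also have "?this \<longleftrightarrow> ((\<lambda>t. ((if \<rho> \<le> t then 1 else 0) - (if \<rho> \<le> 0 then 1 else 0)) / t) has_integral (ln r - ln \<rho>)) {0..r}"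
      using pos by (intro has_integral_cong) auto
    finally show ?thesis using pos True by (simp add: max_def)
  next
    case False
    hence *: "((\<lambda>t. ((if \<rho> \<le> t then 1 else 0) - (if \<rho> \<le> 0 then 1 else 0)) / t) has_integral 0) {0..r} \<longleftrightarrow>
           ((\<lambda>t. 0) has_integral (0::real)) {0..r}"
      using pos by (intro has_integral_cong) auto
    show ?thesis using False pos * by (simp add: max_def)
  qed
qed

lemma integrated_pole_count_shift:
  assumes "f meromorphic_on UNIV" "norm c + r \<le> R" "r > 0"
  shows "integrated_pole_count r (\<lambda>z. f (z + c)) = pole_green f {p \<in> cball 0 R. is_pole f p} c r"
proof -
  define P where "P = {p \<in> cball 0 R. is_pole f p}"
  define m where "m = (\<lambda>p. real (nat (- zorder f p)))"
  define n where "n = (\<lambda>t. real (pole_count t (\<lambda>z. f (z + c))))"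
  have fin: "finite P"
    unfolding P_def by (intro finite_poles assms compact_cball)
  have n: "n t = (\<Sum>p\<in>P. m p * (if norm (p - c) \<le> t then 1 else 0))" if "t \<le> r" for t
    unfolding n_def m_def P_def using assms that
    by (subst pole_count_shift[where R = R]) (auto intro!: sum.cong)
  have "((\<lambda>t. \<Sum>p\<in>P. m p * (((if norm (p - c) \<le> t then 1 else 0) - (if norm (p - c) \<le> 0 then 1 else 0)) / t))
          has_integral (\<Sum>p\<in>P. m p * (if norm (p - c) = 0 then 0 else ln (max r (norm (p - c))) - ln (norm (p - c))))) {0..r}"
    by (intro has_integral_sum fin has_integral_mult_right has_integral_pole_kernel assms norm_ge_zero)
  also have "?this \<longleftrightarrow> ((\<lambda>t. (n t - n 0) / t) has_integral
      (\<Sum>p\<in>P. m p * (if norm (p - c) = 0 then 0 else ln (max r (norm (p - c))) - ln (norm (p - c))))) {0..r}"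
    using assms(3)
    by (intro has_integral_cong)
       (auto simp: n sum_divide_distrib diff_divide_distrib sum_subtractf[symmetric] algebra_simps intro!: sum.cong)
  finally have "integrated_pole_count r (\<lambda>z. f (z + c)) =
      (\<Sum>p\<in>P. m p * (if norm (p - c) = 0 then 0 else ln (max r (norm (p - c))) - ln (norm (p - c)))) + n 0 * ln r"
    unfolding integrated_pole_count_def n_def by (simp add: integral_unique)
  \<comment> \<open>A pole at the centre contributes ln r here, which agrees with
    \<open>ln (max r 0) - ln 0\<close> because ln 0 = 0; the case distinction then
    disappears.\<close>
  also have "n 0 * ln r = (\<Sum>p\<in>P. m p * (if norm (p - c) = 0 then ln r else 0))"
    using assms(3) by (subst n) (auto simp: sum_distrib_right intro!: sum.cong)
  also have "(\<Sum>p\<in>P. m p * (if norm (p - c) = 0 then 0 else ln (max r (norm (p - c))) - ln (norm (p - c)))) + \<dots> =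
      pole_green f P c r"
    unfolding pole_green_def sum.distrib[symmetric] m_def using assms(3)
    by (intro sum.cong) (auto simp: max_def)
  finally show ?thesis unfolding P_def .
qed

section \<open>Solutions of f = w seen from different centres\<close>

lemma is_pole_diff_const_iff: "is_pole (\<lambda>z. f z - w) z \<longleftrightarrow> is_pole f z" for f :: "complex \<Rightarrow> complex"
proof
  assume "is_pole f z"
  from tendsto_add_filterlim_at_infinity'[OF this[unfolded is_pole_def] tendsto_const[of "-w"]]
  show "is_pole (\<lambda>z. f z - w) z" by (simp add: is_pole_def)
next
  assume "is_pole (\<lambda>z. f z - w) z"
  from tendsto_add_filterlim_at_infinity'[OF this[unfolded is_pole_def] tendsto_const[of "w"]]
  show "is_pole f z" by (simp add: is_pole_def)
qed

lemma zorder_diff_const_at_pole: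
  assumes "f meromorphic_on {z}" "is_pole f z" "w \<noteq> 0"
  shows "zorder (\<lambda>z. f z - w) z = zorder f z"
proof (rule zorder_diff1)
  have "isolated_singularity_at f z"
    using assms(1) by (simp add: meromorphic_at_iff)
  thus "zorder f z < zorder (\<lambda>_. w) z"
    using isolated_pole_imp_neg_zorder[of f z] assms by simp
  show "\<exists>\<^sub>F z in at z. f z \<noteq> 0"
    using non_zero_neighbour_pole[OF assms(2)] by (intro eventually_frequently) auto
qed (use assms in \<open>auto intro!: meromorphic_intros\<close>)

text \<open>
  By Jensen's formula this is \<open>N(r, 1 / (f(z + c) - w))\<close> up to a term that does not depend on \<open>r\<close>; unlike
  that counting function it is directly amenable to integration over \<open>w\<close>.
\<close>

definition value_char :: "(complex \<Rightarrow> complex) \<Rightarrow> complex \<Rightarrow> complex \<Rightarrow> real \<Rightarrow> real" where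
  "value_char f w c r =
     integral\<^sup>L circ (\<lambda>\<theta>. ln (norm (f (of_real r * cis \<theta> + c) - w))) / (2 * pi)
     + integrated_pole_count r (\<lambda>z. f (z + c))"

text \<open>In Jensen's formula for f - w the r-dependent pole terms cancel against the integrated
  pole count. What is left besides the zeros is independent of r and drops out of the difference.
  Zeros at distance at least r from c have \<open>green\<close> value 0, so R only has to be large
  enough.\<close>

lemma value_char_diff:
  fixes R :: real
  assumes f: "f meromorphic_on UNIV" and w: "w \<noteq> 0" "\<forall>\<^sub>\<approx>z\<in>UNIV. f z - w \<noteq> 0"
  defines "Z \<equiv> {s \<in> cball 0 R. zorder (\<lambda>z. f z - w) s > 0}"
  assumes r: "r \<ge> 1" "norm c + r < R"
  shows "value_char f w c r - value_char f w c 1 = (\<Sum>s\<in>Z. zorder (\<lambda>z. f z - w) s * green r (s - c))"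
proof -
  define F where "F = (\<lambda>z. f z - w)"
  have F: "F meromorphic_on UNIV" unfolding F_def by (intro meromorphic_intros f)
  have F_nz: "\<forall>\<^sub>\<approx>z\<in>UNIV. F z \<noteq> 0" using w by (simp add: F_def)
  have f_at: "f meromorphic_on {z}" and F_at: "F meromorphic_on {z}" for z
    using f F by (auto intro: meromorphic_on_subset)
  define S where "S = {s. s \<in> cball 0 R \<and> zorder F s \<noteq> 0}"
  define P where "P = {p \<in> cball 0 R. is_pole f p}"
  have fin: "finite S"
    unfolding S_def by (rule finite_zeros_and_poles[OF F F_nz compact_cball])
  have pole_iff: "is_pole f z \<longleftrightarrow> zorder F z < 0" for z
    using zorder_ne_0_iff(2)[OF F_at eventually_cosparse_UNIV_at[OF F_nz]]
    by (simp add: F_def is_pole_diff_const_iff)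
  have S_split: "S = Z \<union> P" "Z \<inter> P = {}"
    unfolding S_def Z_def P_def F_def[symmetric] pole_iff by auto
  have P_zorder: "real (nat (- zorder f p)) = - real_of_int (zorder F p)" if "p \<in> P" for p
    using that zorder_diff_const_at_pole[OF f_at _ w(1), of p] pole_iff[of p] by (simp add: P_def F_def)
  obtain a where a: "\<And>c r. r > 0 \<Longrightarrow> norm c + r < R \<Longrightarrow>
       has_bochner_integral circ (\<lambda>\<theta>. ln (norm (F (of_real r * cis \<theta> + c))))
         (2 * pi * (a c + (\<Sum>s\<in>S. zorder F s * ln (max r (norm (s - c))))))"
    using jensen[OF F F_nz, of R] unfolding S_def by blast
  have char: "value_char f w c r = a c + (\<Sum>s\<in>Z. zorder F s * ln (max r (norm (s - c))))
      + (\<Sum>p\<in>P. zorder F p * ln (norm (p - c)))"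
    if "r > 0" "norm c + r < R" for r
  proof -
    have "value_char f w c r = a c + (\<Sum>s\<in>S. zorder F s * ln (max r (norm (s - c)))) + pole_green f P c r"
      using a[OF that] that unfolding value_char_def P_def
      by (subst integrated_pole_count_shift[OF f, of c r R]) (auto simp: has_bochner_integral_iff F_def)
    also have "(\<Sum>s\<in>S. zorder F s * ln (max r (norm (s - c)))) =
        (\<Sum>s\<in>Z. zorder F s * ln (max r (norm (s - c)))) + (\<Sum>s\<in>P. zorder F s * ln (max r (norm (s - c))))"
      using fin S_split by (simp add: sum.union_disjoint)
    also have "pole_green f P c r =
        (\<Sum>p\<in>P. zorder F p * ln (norm (p - c))) - (\<Sum>p\<in>P. zorder F p * ln (max r (norm (p - c))))"
      unfolding pole_green_def sum_subtractf[symmetric] by (intro sum.cong refl) (simp add: P_zorder algebra_simps)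
    finally show ?thesis by simp
  qed
  have "value_char f w c r - value_char f w c 1 =
      (\<Sum>s\<in>Z. zorder F s * ln (max r (norm (s - c)))) - (\<Sum>s\<in>Z. zorder F s * ln (max 1 (norm (s - c))))"
    using char[of r] char[of 1] r by simp
  also have "\<dots> = (\<Sum>s\<in>Z. zorder F s * green r (s - c))"
    by (simp add: green_def sum_subtractf right_diff_distrib)
  finally show ?thesis by (simp add: F_def)
qed

text \<open>With ln 0 = 0 the case f = w off a sparse set gives 0, so the shift estimate holds for
  every \<alpha> without an exceptional value.\<close>

lemma value_char_constant:
  assumes f: "f meromorphic_on UNIV" and w: "\<forall>\<^sub>\<approx>z\<in>UNIV. f z = w" and "r > 0"
  shows "value_char f w c r = 0"
proof -
  have "AE \<theta> in circ. ln (norm (f (of_real r * cis \<theta> + c) - w)) = 0"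
    using AE_circ_cosparse[OF assms(3) w, of c] by eventually_elim simp
  hence "integral\<^sup>L circ (\<lambda>\<theta>. ln (norm (f (of_real r * cis \<theta> + c) - w))) = 0"
    by (rule integral_eq_zero_AE)
  moreover have "\<not>is_pole f z" for z
  proof -
    have "is_pole f z \<longleftrightarrow> is_pole (\<lambda>_. w) z"
      by (intro is_pole_cong eventually_cosparse_UNIV_at w refl)
    thus ?thesis by simp
  qed
  ultimately show ?thesis
    using integrated_pole_count_shift[OF f order.refl assms(3), of c]
    by (simp add: value_char_def pole_green_def)
qed

text \<open>Sum \<open>green_diff_le_dyadic\<close> over the zeros of f - w; their multiplicities
  are nonnegative weights.\<close>

lemma value_char_shift_le:
  assumes f: "f meromorphic_on UNIV" and w: "w \<noteq> 0"
    and r: "r \<ge> 1" "r + norm \<eta> < 2 ^ Suc K"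
  shows "\<bar>(value_char f w \<eta> r - value_char f w \<eta> 1) - (value_char f w 0 r - value_char f w 0 1)\<bar> \<le>
    norm \<eta> * (1 + norm \<eta>)\<^sup>2 / ln 2 *
      (\<Sum>k\<le>K. (value_char f w 0 (2 ^ (k + 2)) - value_char f w 0 1) / 2 ^ k)"
proof -
  have "(\<forall>\<^sub>\<approx>z\<in>UNIV. f z = w) \<or> (\<forall>\<^sub>\<approx>z\<in>UNIV. f z \<noteq> w)"
    by (intro meromorphic_imp_constant_or_avoid f) auto
  thus ?thesis
  proof
    assume "\<forall>\<^sub>\<approx>z\<in>UNIV. f z = w"
    thus ?thesis using r by (simp add: value_char_constant f)
  next
    assume "\<forall>\<^sub>\<approx>z\<in>UNIV. f z \<noteq> w"
    hence nz: "\<forall>\<^sub>\<approx>z\<in>UNIV. f z - w \<noteq> 0" by simp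
    define C where "C = norm \<eta> * (1 + norm \<eta>)\<^sup>2 / ln 2"
    \<comment> \<open>Exceeds r + |\<eta>| and every dyadic radius 2^(k+2) with k <= K, so one set Z
      serves all terms.\<close>
    define R :: real where "R = 2 ^ (K + 3)"
    define Z where "Z = {s \<in> cball 0 R. zorder (\<lambda>z. f z - w) s > 0}"
    define m where "m = (\<lambda>s. real_of_int (zorder (\<lambda>z. f z - w) s))"
    have m: "m s \<ge> 0" if "s \<in> Z" for s
      using that by (simp add: m_def Z_def)
    have diff: "value_char f w c r - value_char f w c 1 = (\<Sum>s\<in>Z. m s * green r (s - c))"
      if "r \<ge> 1" "norm c + r < R" for c r
      using value_char_diff[OF f w nz that] by (simp add: Z_def m_def)
    have "(2::real) ^ Suc K \<le> R" unfolding R_def by (intro power_increasing) auto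
    hence "r + norm \<eta> < R" using r by linarith
    hence "\<bar>(value_char f w \<eta> r - value_char f w \<eta> 1) - (value_char f w 0 r - value_char f w 0 1)\<bar> =
        \<bar>\<Sum>s\<in>Z. m s * (green r (s - \<eta>) - green r s)\<bar>"
      using diff[of r \<eta>] diff[of r 0] r norm_ge_zero[of \<eta>]
      by (simp add: sum_subtractf right_diff_distrib add.commute)
    also have "\<dots> \<le> (\<Sum>s\<in>Z. \<bar>m s * (green r (s - \<eta>) - green r s)\<bar>)"
      by (rule sum_abs)
    also have "\<dots> \<le> (\<Sum>s\<in>Z. m s * (C * (\<Sum>k\<le>K. green (2 ^ (k + 2)) s / 2 ^ k)))"
      unfolding C_def abs_mult using m r
      by (intro sum_mono mult_mono green_diff_le_dyadic) auto
    also have "\<dots> = C * (\<Sum>k\<le>K. (\<Sum>s\<in>Z. m s * green (2 ^ (k + 2)) (s - 0)) / 2 ^ k)"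
      by (subst sum.swap[of _ Z, symmetric] | simp add: sum_distrib_left sum_divide_distrib mult_ac)+
    also have "(\<Sum>k\<le>K. (\<Sum>s\<in>Z. m s * green (2 ^ (k + 2)) (s - 0)) / 2 ^ k) =
        (\<Sum>k\<le>K. (value_char f w 0 (2 ^ (k + 2)) - value_char f w 0 1) / 2 ^ k)"
    proof (intro sum.cong refl)
      fix k assume "k \<in> {..K}"
      hence "(2::real) ^ (k + 2) < R" unfolding R_def by (intro power_strict_increasing) auto
      thus "(\<Sum>s\<in>Z. m s * green (2 ^ (k + 2)) (s - 0)) / 2 ^ k =
          (value_char f w 0 (2 ^ (k + 2)) - value_char f w 0 1) / 2 ^ k"
        using diff[of "2 ^ (k + 2)" 0] one_le_power[of "2::real" "k + 2"] by simp
    qed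
    finally show ?thesis by (simp add: C_def)
  qed
qed

subsection \<open>Cartan's identity\<close>

lemma log_plus_eq: "x \<ge> 0 \<Longrightarrow> log_plus x = max 0 (ln x)"
  by (cases "x = 0") (auto simp: log_plus_def max_def)

lemma log_plus_nonneg: "log_plus x \<ge> 0"
  by (simp add: log_plus_def)

lemma integrable_circ_ln_norm:
  assumes "f meromorphic_on UNIV" "r > 0"
  shows "integrable circ (\<lambda>\<theta>. ln (norm (f (of_real r * cis \<theta> + c))))"
proof -
  have [measurable]: "f \<in> borel_measurable borel"
    by (intro meromorphic_borel_measurable assms)
  have "(\<forall>\<^sub>\<approx>z\<in>UNIV. f z = 0) \<or> (\<forall>\<^sub>\<approx>z\<in>UNIV. f z \<noteq> 0)"
    by (intro meromorphic_imp_constant_or_avoid assms) auto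
  thus ?thesis
  proof
    assume "\<forall>\<^sub>\<approx>z\<in>UNIV. f z = 0"
    from AE_circ_cosparse[OF assms(2) this, of c]
    have "AE \<theta> in circ. ln (norm (f (of_real r * cis \<theta> + c))) = 0"
      by eventually_elim simp
    moreover have "(\<lambda>\<theta>. ln (norm (f (of_real r * cis \<theta> + c)))) \<in> borel_measurable circ"
      by (intro borel_measurable_imp_circ) measurable
    ultimately show ?thesis
      by (subst integrable_cong_AE[where g = "\<lambda>_. 0"]) auto
  next
    assume "\<forall>\<^sub>\<approx>z\<in>UNIV. f z \<noteq> 0"
    from jensen[OF assms(1) this, of "norm c + r + 1"] assms(2) show ?thesis
      unfolding has_bochner_integral_iff by force
  qed
qed

lemma integrable_circ_log_plus:
  assumes "f meromorphic_on UNIV" "r > 0"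
  shows "integrable circ (\<lambda>\<theta>. log_plus (norm (f (of_real r * cis \<theta> + c))))"
  using integrable_circ_ln_norm[OF assms, of c] by (simp add: log_plus_eq)

text \<open>The mean over the unit circle with u as the fixed point: ln (max 1 |u|) is exactly
  \<open>log_plus\<close>.\<close>

lemma has_bochner_integral_ln_norm_diff_cis:
  "has_bochner_integral circ (\<lambda>\<alpha>. ln (norm (u - cis \<alpha>))) (2 * pi * log_plus (norm u))"
  using circle_mean_ln_norm_diff[of 1 u] by (simp add: log_plus_def norm_minus_commute)

text \<open>Supplies the absolute bound for Fubini. With M = ln 2 + log_plus |u|, both 0 and x = ln
  |u - cis \<alpha>| are at most M, so |x| <= 2 M - x, and the mean of x is known.\<close>

lemma integral_abs_ln_norm_diff_cis_le:
  "integral\<^sup>L circ (\<lambda>\<alpha>. \<bar>ln (norm (u - cis \<alpha>))\<bar>) \<le> 2 * pi * (2 * ln 2 + log_plus (norm u))"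
proof -
  define c where "c = 2 * (ln 2 + log_plus (norm u))"
  have *: "has_bochner_integral circ (\<lambda>\<alpha>. c - ln (norm (u - cis \<alpha>))) (2 * pi * c - 2 * pi * log_plus (norm u))"
    by (intro has_bochner_integral_diff has_bochner_integral_circ_const has_bochner_integral_ln_norm_diff_cis)
  have "\<bar>ln (norm (u - cis \<alpha>))\<bar> \<le> c - ln (norm (u - cis \<alpha>))" for \<alpha>
  proof -
    have "ln (norm (u - cis \<alpha>)) \<le> ln 2 + log_plus (norm u)"
    proof (cases "u = cis \<alpha>")
      case False
      have "norm (u - cis \<alpha>) \<le> norm u + 1"
        using norm_triangle_ineq4[of u "cis \<alpha>"] by simp
      also have "\<dots> \<le> 2 * max 1 (norm u)" by simp
      finally have "ln (norm (u - cis \<alpha>)) \<le> ln (2 * max 1 (norm u))"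
        using False by simp
      also have "\<dots> = ln 2 + ln (max 1 (norm u))"
        by (rule ln_mult_pos) auto
      finally show ?thesis by (simp add: log_plus_def)
    qed (simp add: log_plus_nonneg)
    moreover have "ln 2 + log_plus (norm u) \<ge> 0" by (simp add: log_plus_nonneg)
    ultimately show ?thesis by (simp add: c_def)
  qed
  hence "integral\<^sup>L circ (\<lambda>\<alpha>. \<bar>ln (norm (u - cis \<alpha>))\<bar>) \<le> integral\<^sup>L circ (\<lambda>\<alpha>. c - ln (norm (u - cis \<alpha>)))"
    using * has_bochner_integral_ln_norm_diff_cis[of u]
    by (intro integral_mono) (auto simp: has_bochner_integral_iff)
  also have "\<dots> = 2 * pi * c - 2 * pi * log_plus (norm u)"
    using * by (simp add: has_bochner_integral_iff)
  finally show ?thesis by (simp add: c_def algebra_simps)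
qed

text \<open>Exchange the integrals over \<theta> and \<alpha>: the inner mean over \<alpha> produces
  \<open>log_plus\<close> and hence the proximity function, while the pole term does not depend on
  \<alpha>.\<close>

theorem cartan_identity:
  assumes f: "f meromorphic_on UNIV" and r: "r > 0"
  shows "has_bochner_integral circ (\<lambda>\<alpha>. value_char f (cis \<alpha>) c r) (2 * pi * nevanlinna_char r (\<lambda>z. f (z + c)))"
proof -
  define u where "u = (\<lambda>\<theta>. f (of_real r * cis \<theta> + c))"
  define N where "N = integrated_pole_count r (\<lambda>z. f (z + c))"
  have f_meas [measurable]: "f \<in> borel_measurable borel"
    by (intro meromorphic_borel_measurable f)
  have [measurable]: "u \<in> borel_measurable circ"
    unfolding u_def by (intro borel_measurable_imp_circ) measurable
  have [measurable]: "cis \<in> borel_measurable circ"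
    by (intro borel_measurable_imp_circ borel_measurable_cis)
  have lp: "integrable circ (\<lambda>\<theta>. log_plus (norm (u \<theta>)))"
    unfolding u_def by (rule integrable_circ_log_plus[OF f r])
  have int: "integrable (circ \<Otimes>\<^sub>M circ) (\<lambda>(\<theta>, \<alpha>). ln (norm (u \<theta> - cis \<alpha>)))"
  proof (rule circ_pair.Fubini_integrable)
    show meas: "(\<lambda>(\<theta>, \<alpha>). ln (norm (u \<theta> - cis \<alpha>))) \<in> borel_measurable (circ \<Otimes>\<^sub>M circ)"
      by measurable
    show "AE \<theta> in circ. integrable circ (\<lambda>\<alpha>. case (\<theta>, \<alpha>) of (\<theta>, \<alpha>) \<Rightarrow> ln (norm (u \<theta> - cis \<alpha>)))"
      using has_bochner_integral_ln_norm_diff_cis by (auto simp: has_bochner_integral_iff)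
    have "integrable circ (\<lambda>\<theta>. 2 * pi * (2 * ln 2 + log_plus (norm (u \<theta>))))"
      by (intro Bochner_Integration.integrable_mult_right Bochner_Integration.integrable_add
            circ.integrable_const lp)
    moreover have "(\<lambda>\<theta>. integral\<^sup>L circ (\<lambda>\<alpha>. \<bar>ln (norm (u \<theta> - cis \<alpha>))\<bar>)) \<in> borel_measurable circ"
      by measurable
    ultimately have "integrable circ (\<lambda>\<theta>. integral\<^sup>L circ (\<lambda>\<alpha>. \<bar>ln (norm (u \<theta> - cis \<alpha>))\<bar>))"
    proof (rule Bochner_Integration.integrable_bound)
      have "0 \<le> integral\<^sup>L circ (\<lambda>\<alpha>. \<bar>ln (norm (u \<theta> - cis \<alpha>))\<bar>)" for \<theta>
        by (intro integral_nonneg_AE) auto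
      thus "AE \<theta> in circ. norm (integral\<^sup>L circ (\<lambda>\<alpha>. \<bar>ln (norm (u \<theta> - cis \<alpha>))\<bar>)) \<le>
          norm (2 * pi * (2 * ln 2 + log_plus (norm (u \<theta>))))"
        using integral_abs_ln_norm_diff_cis_le log_plus_nonneg by (auto intro!: AE_I2 simp: abs_mult)
    qed
    thus "integrable circ (\<lambda>\<theta>. \<integral>\<alpha>. norm (case (\<theta>, \<alpha>) of (\<theta>, \<alpha>) \<Rightarrow> ln (norm (u \<theta> - cis \<alpha>))) \<partial>circ)"
      by simp
  qed
  have "integral\<^sup>L circ (\<lambda>\<alpha>. integral\<^sup>L circ (\<lambda>\<theta>. ln (norm (u \<theta> - cis \<alpha>)))) =
      integral\<^sup>L circ (\<lambda>\<theta>. integral\<^sup>L circ (\<lambda>\<alpha>. ln (norm (u \<theta> - cis \<alpha>))))"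
    using circ_pair.Fubini_integral[OF int] .
  also have "\<dots> = integral\<^sup>L circ (\<lambda>\<theta>. 2 * pi * log_plus (norm (u \<theta>)))"
    using has_bochner_integral_ln_norm_diff_cis
    by (intro Bochner_Integration.integral_cong refl) (auto simp: has_bochner_integral_iff)
  also have "\<dots> = 2 * pi * integral {0..2 * pi} (\<lambda>\<theta>. log_plus (norm (u \<theta>)))"
    using integral_circ_eq[OF lp] by simp
  also have "\<dots> = 2 * pi * (2 * pi * proximity r (\<lambda>z. f (z + c)))"
    by (simp add: proximity_def u_def)
  finally have "has_bochner_integral circ (\<lambda>\<alpha>. integral\<^sup>L circ (\<lambda>\<theta>. ln (norm (u \<theta> - cis \<alpha>))))
      (2 * pi * (2 * pi * proximity r (\<lambda>z. f (z + c))))"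
    using circ_pair.integrable_snd[OF int] by (simp add: has_bochner_integral_iff)
  hence "has_bochner_integral circ (\<lambda>\<alpha>. integral\<^sup>L circ (\<lambda>\<theta>. ln (norm (u \<theta> - cis \<alpha>))) / (2 * pi) + N)
      (2 * pi * (2 * pi * proximity r (\<lambda>z. f (z + c))) / (2 * pi) + 2 * pi * N)"
    by (intro has_bochner_integral_add has_bochner_integral_divide has_bochner_integral_circ_const) auto
  thus ?thesis
    by (simp add: value_char_def u_def N_def nevanlinna_char_def distrib_left mult.assoc)
qed

text \<open>Both sides of \<open>value_char_shift_le\<close> are built linearly from
  \<open>value_char\<close>, apart from the absolute value, so integrating over \<alpha> replaces it
  by the characteristic on both sides.\<close>

theorem nevanlinna_char_shift_le:
  assumes f: "f meromorphic_on UNIV" and r: "r \<ge> 1" "r + norm \<eta> < 2 ^ Suc K"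
  defines "T \<equiv> \<lambda>c r. nevanlinna_char r (\<lambda>z. f (z + c))"
  shows "\<bar>(T \<eta> r - T \<eta> 1) - (T 0 r - T 0 1)\<bar> \<le>
    norm \<eta> * (1 + norm \<eta>)\<^sup>2 / ln 2 * (\<Sum>k\<le>K. (T 0 (2 ^ (k + 2)) - T 0 1) / 2 ^ k)"
proof -
  define C where "C = norm \<eta> * (1 + norm \<eta>)\<^sup>2 / ln 2"
  define v where "v = (\<lambda>c r \<alpha>. value_char f (cis \<alpha>) c r)"
  have v: "has_bochner_integral circ (v c r) (2 * pi * T c r)" if "r > 0" for c r
    using cartan_identity[OF f that] by (simp add: v_def T_def)
  have lhs: "has_bochner_integral circ (\<lambda>\<alpha>. (v \<eta> r \<alpha> - v \<eta> 1 \<alpha>) - (v 0 r \<alpha> - v 0 1 \<alpha>))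
      ((2 * pi * T \<eta> r - 2 * pi * T \<eta> 1) - (2 * pi * T 0 r - 2 * pi * T 0 1))"
    using r by (intro has_bochner_integral_diff v) auto
  have rhs: "has_bochner_integral circ (\<lambda>\<alpha>. C * (\<Sum>k\<le>K. (v 0 (2 ^ (k + 2)) \<alpha> - v 0 1 \<alpha>) / 2 ^ k))
      (C * (\<Sum>k\<le>K. (2 * pi * T 0 (2 ^ (k + 2)) - 2 * pi * T 0 1) / 2 ^ k))"
    by (intro has_bochner_integral_mult_right has_bochner_integral_sum has_bochner_integral_divide
          has_bochner_integral_diff v) auto
  have le: "\<bar>(v \<eta> r \<alpha> - v \<eta> 1 \<alpha>) - (v 0 r \<alpha> - v 0 1 \<alpha>)\<bar> \<le>
      C * (\<Sum>k\<le>K. (v 0 (2 ^ (k + 2)) \<alpha> - v 0 1 \<alpha>) / 2 ^ k)" for \<alpha>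
    unfolding v_def C_def by (intro value_char_shift_le f r) simp
  have "\<bar>integral\<^sup>L circ (\<lambda>\<alpha>. (v \<eta> r \<alpha> - v \<eta> 1 \<alpha>) - (v 0 r \<alpha> - v 0 1 \<alpha>))\<bar> \<le>
      integral\<^sup>L circ (\<lambda>\<alpha>. \<bar>(v \<eta> r \<alpha> - v \<eta> 1 \<alpha>) - (v 0 r \<alpha> - v 0 1 \<alpha>)\<bar>)"
    by (rule integral_abs_bound)
  also have "\<dots> \<le> integral\<^sup>L circ (\<lambda>\<alpha>. C * (\<Sum>k\<le>K. (v 0 (2 ^ (k + 2)) \<alpha> - v 0 1 \<alpha>) / 2 ^ k))"
    by (intro integral_mono integrable_abs le has_bochner_integral_iff[THEN iffD1, OF lhs, THEN conjunct1]
          has_bochner_integral_iff[THEN iffD1, OF rhs, THEN conjunct1])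
  finally have "\<bar>integral\<^sup>L circ (\<lambda>\<alpha>. (v \<eta> r \<alpha> - v \<eta> 1 \<alpha>) - (v 0 r \<alpha> - v 0 1 \<alpha>))\<bar> \<le>
      integral\<^sup>L circ (\<lambda>\<alpha>. C * (\<Sum>k\<le>K. (v 0 (2 ^ (k + 2)) \<alpha> - v 0 1 \<alpha>) / 2 ^ k))" .
  hence "\<bar>(2 * pi * T \<eta> r - 2 * pi * T \<eta> 1) - (2 * pi * T 0 r - 2 * pi * T 0 1)\<bar> \<le>
      C * (\<Sum>k\<le>K. (2 * pi * T 0 (2 ^ (k + 2)) - 2 * pi * T 0 1) / 2 ^ k)"
    using lhs rhs by (simp only: has_bochner_integral_iff)
  also have "(2 * pi * T \<eta> r - 2 * pi * T \<eta> 1) - (2 * pi * T 0 r - 2 * pi * T 0 1) =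
      2 * pi * ((T \<eta> r - T \<eta> 1) - (T 0 r - T 0 1))"
    by (simp add: algebra_simps)
  also have "C * (\<Sum>k\<le>K. (2 * pi * T 0 (2 ^ (k + 2)) - 2 * pi * T 0 1) / 2 ^ k) =
      2 * pi * (C * (\<Sum>k\<le>K. (T 0 (2 ^ (k + 2)) - T 0 1) / 2 ^ k))"
    by (simp add: sum_distrib_left right_diff_distrib diff_divide_distrib sum_subtractf mult_ac)
  also have "\<bar>2 * pi * ((T \<eta> r - T \<eta> 1) - (T 0 r - T 0 1))\<bar> = 2 * pi * \<bar>(T \<eta> r - T \<eta> 1) - (T 0 r - T 0 1)\<bar>"
    by (simp add: abs_mult)
  finally show ?thesis
    unfolding C_def[symmetric] by (subst (asm) mult_le_cancel_left_pos) auto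
qed

subsection \<open>Growth estimates\<close>

text \<open>The second conclusion holds because \<open>log_plus\<close> is nonnegative, so the
  quotients in the limsup are nonnegative for r > 1. It later lets powers 2^(k (\<sigma> +
  \<epsilon>)) >= 1 absorb constants.\<close>

lemma nevanlinna_char_le_powr:
  assumes "growth_order f = ereal \<sigma>" "\<epsilon> > 0"
  shows "\<forall>\<^sub>F r in at_top. nevanlinna_char r f \<le> r powr (\<sigma> + \<epsilon>)" and "\<sigma> + \<epsilon> > 0"
proof -
  have "Limsup at_top (\<lambda>r. ereal (log_plus (nevanlinna_char r f) / ln r)) < ereal (\<sigma> + \<epsilon>)"
    using assms by (simp add: growth_order_def)
  from Limsup_lessD[OF this]
  have ev: "\<forall>\<^sub>F r in at_top. log_plus (nevanlinna_char r f) / ln r < \<sigma> + \<epsilon>"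
    by simp
  show "\<forall>\<^sub>F r in at_top. nevanlinna_char r f \<le> r powr (\<sigma> + \<epsilon>)"
    using ev eventually_gt_at_top[of 1]
  proof eventually_elim
    case (elim r)
    have "nevanlinna_char r f \<le> exp (log_plus (nevanlinna_char r f))"
      by (simp add: log_plus_def)
    also have "\<dots> \<le> exp ((\<sigma> + \<epsilon>) * ln r)"
      using elim by (simp add: field_simps)
    finally show ?case using elim by (simp add: powr_def)
  qed
  have "\<forall>\<^sub>F r::real in at_top. \<sigma> + \<epsilon> > 0"
    using ev eventually_gt_at_top[of 1]
  proof eventually_elim
    case (elim r)
    have "0 \<le> log_plus (nevanlinna_char r f) / ln r"
      using elim by (intro divide_nonneg_nonneg log_plus_nonneg) auto
    thus ?case using elim by linarith
  qed
  thus "\<sigma> + \<epsilon> > 0" by simp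
qed

lemma nevanlinna_char_dyadic_le:
  assumes "growth_order f = ereal \<sigma>" "\<epsilon> > 0"
  obtains A where "A \<ge> 0"
    "\<And>k. nevanlinna_char (2 ^ (k + 2)) f - nevanlinna_char 1 f \<le> A * 2 powr (real k * (\<sigma> + \<epsilon>))"
proof -
  define T where "T = (\<lambda>r. nevanlinna_char r f)"
  define s where "s = \<sigma> + \<epsilon>"
  have s: "s > 0" using nevanlinna_char_le_powr(2)[OF assms] by (simp add: s_def)
  have "\<forall>\<^sub>F r in at_top. T r \<le> r powr s"
    using nevanlinna_char_le_powr(1)[OF assms] by (simp add: T_def s_def)
  moreover have "filterlim (\<lambda>k::nat. (2::real) ^ (k + 2)) at_top sequentially"
    by real_asymp
  ultimately have "\<forall>\<^sub>F k in sequentially. T (2 ^ (k + 2)) \<le> (2 ^ (k + 2)) powr s"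
    by (rule eventually_compose_filterlim)
  then obtain k0 where k0: "\<And>k. k \<ge> k0 \<Longrightarrow> T (2 ^ (k + 2)) \<le> (2 ^ (k + 2)) powr s"
    by (auto simp: eventually_sequentially)
  define B where "B = (\<Sum>k<k0. \<bar>T (2 ^ (k + 2)) - T 1\<bar>)"
  \<comment> \<open>\<open>B\<close> covers the finitely many k below \<open>k0\<close>,
    \<open>4 powr s\<close> comes from the two extra factors 2 in the radius, and the last term
    bounds -T(1).\<close>
  define A where "A = B + 4 powr s + \<bar>T 1\<bar>"
  have "B \<ge> 0" by (auto simp: B_def)
  show ?thesis
  proof (rule that[of A])
    show "A \<ge> 0" using \<open>B \<ge> 0\<close> by (simp add: A_def)
    fix k
    have ge1: "1 \<le> 2 powr (real k * s)" using s by (intro ge_one_powr_ge_zero) auto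
    show "nevanlinna_char (2 ^ (k + 2)) f - nevanlinna_char 1 f \<le> A * 2 powr (real k * (\<sigma> + \<epsilon>))"
    proof (cases "k < k0")
      case True
      have "T (2 ^ (k + 2)) - T 1 \<le> \<bar>T (2 ^ (k + 2)) - T 1\<bar>" by simp
      also have "\<dots> \<le> B" unfolding B_def using True by (intro member_le_sum) auto
      also have "\<dots> \<le> A * 1" by (simp add: A_def)
      also have "\<dots> \<le> A * 2 powr (real k * s)"
        using ge1 \<open>A \<ge> 0\<close> by (rule mult_left_mono)
      finally show ?thesis by (simp add: T_def s_def)
    next
      case False
      have "T (2 ^ (k + 2)) - T 1 \<le> (2 ^ (k + 2)) powr s + \<bar>T 1\<bar> * 1"
        using k0[of k] False by linarith
      also have "(2 ^ (k + 2)) powr s = 4 powr s * 2 powr (real k * s)"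
        by (simp add: powr_mult powr_powr flip: powr_realpow)
      also have "\<dots> + \<bar>T 1\<bar> * 1 \<le> 4 powr s * 2 powr (real k * s) + \<bar>T 1\<bar> * 2 powr (real k * s)"
        using ge1 by (intro add_left_mono mult_left_mono) auto
      also have "\<dots> \<le> A * 2 powr (real k * s)"
        unfolding distrib_right[symmetric] using \<open>B \<ge> 0\<close> by (intro mult_right_mono) (auto simp: A_def)
      finally show ?thesis by (simp add: T_def s_def)
    qed
  qed
qed

text \<open>Every term is at most 1 and K is at most the binary logarithm of x; this is the source
  of the O(log r) term.\<close>

lemma sum_dyadic_powr_le_linear:
  assumes "\<beta> \<le> 0" "2 ^ K \<le> x"
  shows "(\<Sum>k\<le>K. 2 powr (real k * \<beta>)) \<le> 1 + ln x / ln 2"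
proof -
  have "2 powr (real k * \<beta>) \<le> 1" for k
    using powr_mono[of "real k * \<beta>" 0 2] assms(1) by (simp add: mult_nonneg_nonpos)
  hence "(\<Sum>k\<le>K. 2 powr (real k * \<beta>)) \<le> (\<Sum>k\<le>K. 1)"
    by (intro sum_mono)
  moreover have "real K * ln 2 \<le> ln x"
  proof -
    have "real K * ln 2 = ln (2 ^ K)" by (simp add: ln_realpow)
    also have "\<dots> \<le> ln x" using assms(2) less_le_trans[of 0 "2 ^ K" x] by simp
    finally show ?thesis .
  qed
  hence "real K \<le> ln x / ln 2" by (simp add: field_simps)
  ultimately show ?thesis by simp
qed

text \<open>An increasing geometric sum is comparable to its last term.\<close>

lemma sum_dyadic_powr_le_powr:
  assumes "\<beta> > 0" "2 ^ K \<le> x"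
  shows "(\<Sum>k\<le>K. 2 powr (real k * \<beta>)) \<le> 2 powr \<beta> / (2 powr \<beta> - 1) * x powr \<beta>"
proof -
  define q where "q = 2 powr \<beta>"
  have q: "q > 1" using assms by (simp add: q_def)
  have "(\<Sum>k\<le>K. 2 powr (real k * \<beta>)) = (\<Sum>k<Suc K. q ^ k)"
    by (intro sum.cong) (auto simp: q_def powr_powr mult.commute simp flip: powr_realpow)
  also have "\<dots> = (q ^ Suc K - 1) / (q - 1)"
    using q by (subst geometric_sum) auto
  also have "\<dots> \<le> q ^ Suc K / (q - 1)"
    using q by (intro divide_right_mono) auto
  also have "q ^ Suc K = q * (2 ^ K) powr \<beta>"
    by (simp add: q_def powr_powr mult.commute flip: powr_realpow)
  also have "\<dots> / (q - 1) \<le> q * x powr \<beta> / (q - 1)"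
    using q assms by (intro divide_right_mono mult_left_mono powr_mono2) auto
  finally show ?thesis by (simp add: q_def)
qed

text \<open>Only K depends on r, and it does so through 2^K <= (1 + |\<eta>|) r, which leaves both
  signs of the exponent to be treated separately.\<close>

lemma nevanlinna_char_shift_diff_le:
  fixes \<sigma> \<epsilon> :: real
  assumes f: "f meromorphic_on UNIV" and "growth_order f = ereal \<sigma>" "\<epsilon> > 0"
  obtains B C where "C \<ge> 0"
    "\<And>r. r \<ge> 1 \<Longrightarrow> \<exists>K. 2 ^ K \<le> (1 + norm \<eta>) * r \<and>
      \<bar>nevanlinna_char r (\<lambda>z. f (z + \<eta>)) - nevanlinna_char r f\<bar> \<le>
        B + C * (\<Sum>k\<le>K. 2 powr (real k * (\<sigma> - 1 + \<epsilon>)))"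
proof -
  define T where "T = (\<lambda>c r. nevanlinna_char r (\<lambda>z. f (z + c)))"
  define D where "D = norm \<eta> * (1 + norm \<eta>)\<^sup>2 / ln 2"
  have "D \<ge> 0" by (auto simp: D_def intro!: divide_nonneg_nonneg)
  obtain A where A: "A \<ge> 0" "\<And>k. T 0 (2 ^ (k + 2)) - T 0 1 \<le> A * 2 powr (real k * (\<sigma> + \<epsilon>))"
    using nevanlinna_char_dyadic_le[OF assms(2,3)] by (auto simp: T_def)
  show ?thesis
  \<comment> \<open>\<open>C\<close> is the first variable to occur in \<open>that\<close>, so
    \<open>D * A\<close> instantiates \<open>C\<close> and the second term \<open>B\<close>.\<close>
  proof (rule that[of "D * A" "\<bar>T \<eta> 1 - T 0 1\<bar>"])
    show "D * A \<ge> 0" using A \<open>D \<ge> 0\<close> by simp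
    fix r :: real assume r: "r \<ge> 1"
    obtain n where "r + norm \<eta> < 2 ^ n"
      using real_arch_pow[of 2 "r + norm \<eta>"] by auto
    hence "r + norm \<eta> < 2 ^ Suc n"
      using power_increasing[of n "Suc n" "2::real"] by linarith
    then obtain K where K: "2 ^ K \<le> r + norm \<eta>" "r + norm \<eta> < 2 ^ Suc K"
      using ex_dyadic_interval[of "r + norm \<eta>" n] r norm_ge_zero[of \<eta>] by (meson add_increasing2)
    have "norm \<eta> \<le> norm \<eta> * r" using mult_left_mono[OF r, of "norm \<eta>"] by simp
    hence "2 ^ K \<le> (1 + norm \<eta>) * r" using K by (simp add: distrib_right)
    moreover have "\<bar>T \<eta> r - T 0 r\<bar> \<le> \<bar>T \<eta> 1 - T 0 1\<bar> + D * A * (\<Sum>k\<le>K. 2 powr (real k * (\<sigma> - 1 + \<epsilon>)))"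
    proof -
      have "\<bar>(T \<eta> r - T \<eta> 1) - (T 0 r - T 0 1)\<bar> \<le> D * (\<Sum>k\<le>K. (T 0 (2 ^ (k + 2)) - T 0 1) / 2 ^ k)"
        using nevanlinna_char_shift_le[OF f r K(2)] by (simp add: T_def D_def)
      also have "\<dots> \<le> D * (\<Sum>k\<le>K. A * 2 powr (real k * (\<sigma> + \<epsilon>)) / 2 ^ k)"
        using A(2) \<open>D \<ge> 0\<close> by (intro mult_left_mono sum_mono divide_right_mono) auto
      \<comment> \<open>The weight 1 / 2^k lowers the exponent by one: this is the gain from
        \<sigma> + \<epsilon> to \<sigma> - 1 + \<epsilon>.\<close>
      also have "(\<Sum>k\<le>K. A * 2 powr (real k * (\<sigma> + \<epsilon>)) / 2 ^ k) = A * (\<Sum>k\<le>K. 2 powr (real k * (\<sigma> - 1 + \<epsilon>)))"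
        unfolding sum_distrib_left
      proof (intro sum.cong refl)
        fix k
        have "2 powr (real k * (\<sigma> - 1 + \<epsilon>)) = 2 powr (real k * (\<sigma> + \<epsilon>) - real k)"
          by (simp add: algebra_simps)
        also have "\<dots> = 2 powr (real k * (\<sigma> + \<epsilon>)) / 2 ^ k"
          by (simp add: powr_diff powr_realpow)
        finally show "A * 2 powr (real k * (\<sigma> + \<epsilon>)) / 2 ^ k = A * 2 powr (real k * (\<sigma> - 1 + \<epsilon>))"
          by simp
      qed
      finally show ?thesis by (simp add: mult.assoc)
    qed
    ultimately show "\<exists>K. 2 ^ K \<le> (1 + norm \<eta>) * r \<and>
      \<bar>nevanlinna_char r (\<lambda>z. f (z + \<eta>)) - nevanlinna_char r f\<bar> \<le>
        \<bar>T \<eta> 1 - T 0 1\<bar> + D * A * (\<Sum>k\<le>K. 2 powr (real k * (\<sigma> - 1 + \<epsilon>)))"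
      by (auto simp: T_def)
  qed
qed

theorem theorem2p1:
  fixes f :: "complex \<Rightarrow> complex" and \<eta> :: complex and \<sigma> \<epsilon> :: real
  assumes "f meromorphic_on UNIV"
    and "growth_order f = ereal \<sigma>"
    and "\<eta> \<noteq> 0"
    and "\<epsilon> > 0"
  shows "\<exists>E1 E2 :: real \<Rightarrow> real.
           E1 \<in> O[at_top](\<lambda>r. r powr (\<sigma> - 1 + \<epsilon>)) \<and>
           E2 \<in> O[at_top](\<lambda>r. ln r) \<and>
           (\<forall>\<^sub>F r in at_top.
              nevanlinna_char r (\<lambda>z. f (z + \<eta>)) = nevanlinna_char r f + E1 r + E2 r)"
proof -
  define E where "E = (\<lambda>r. nevanlinna_char r (\<lambda>z. f (z + \<eta>)) - nevanlinna_char r f)"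
  define \<beta> where "\<beta> = \<sigma> - 1 + \<epsilon>"
  define d where "d = 1 + norm \<eta>"
  have d: "d > 0" by (simp add: d_def add_pos_nonneg)
  obtain B C where BC: "C \<ge> 0" "\<And>r. r \<ge> 1 \<Longrightarrow> \<exists>K. 2 ^ K \<le> d * r \<and>
      \<bar>E r\<bar> \<le> B + C * (\<Sum>k\<le>K. 2 powr (real k * \<beta>))"
    using nevanlinna_char_shift_diff_le[OF assms(1,2,4), of \<eta>] unfolding E_def \<beta>_def d_def by metis
  \<comment> \<open>The sign of \<beta> decides which error term takes the whole difference: the
    logarithm if \<beta> <= 0, the power otherwise. The other one is 0.\<close>
  show ?thesis
  proof (cases "\<beta> \<le> 0")
    case True
    have "\<forall>\<^sub>F r in at_top. norm (E r) \<le> 1 * norm (B + C * (1 + (ln d + ln r) / ln 2))"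
      using eventually_ge_at_top[of 1]
    proof eventually_elim
      case (elim r)
      then obtain K where K: "2 ^ K \<le> d * r" "\<bar>E r\<bar> \<le> B + C * (\<Sum>k\<le>K. 2 powr (real k * \<beta>))"
        using BC(2) by blast
      have "(\<Sum>k\<le>K. 2 powr (real k * \<beta>)) \<le> 1 + ln (d * r) / ln 2"
        by (rule sum_dyadic_powr_le_linear[OF True K(1)])
      also have "ln (d * r) = ln d + ln r" using d elim by (intro ln_mult_pos) auto
      finally have "C * (\<Sum>k\<le>K. 2 powr (real k * \<beta>)) \<le> C * (1 + (ln d + ln r) / ln 2)"
        using BC(1) by (rule mult_left_mono)
      with K(2) show ?case by simp
    qed
    hence "E \<in> O[at_top](\<lambda>r. B + C * (1 + (ln d + ln r) / ln 2))"
      by (rule bigoI)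
    also have "(\<lambda>r. B + C * (1 + (ln d + ln r) / ln 2)) =
        (\<lambda>r. (B + C * (1 + ln d / ln 2)) + C / ln 2 * ln r)"
      by (auto simp: field_simps)
    also have "\<dots> \<in> O[at_top](\<lambda>r. ln r)"
    proof (rule sum_in_bigo)
      show "(\<lambda>r::real. B + C * (1 + ln d / ln 2)) \<in> O[at_top](\<lambda>r. ln r)" by real_asymp
    qed simp
    finally show ?thesis
      by (intro exI[of _ "\<lambda>_. 0"] exI[of _ E]) (auto simp: E_def)
  next
    case False
    define q where "q = 2 powr \<beta> / (2 powr \<beta> - 1)"
    have "\<forall>\<^sub>F r in at_top. norm (E r) \<le> 1 * norm (B + C * (q * (d * r) powr \<beta>))"
      using eventually_ge_at_top[of 1]
    proof eventually_elim
      case (elim r)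
      then obtain K where K: "2 ^ K \<le> d * r" "\<bar>E r\<bar> \<le> B + C * (\<Sum>k\<le>K. 2 powr (real k * \<beta>))"
        using BC(2) by blast
      have "(\<Sum>k\<le>K. 2 powr (real k * \<beta>)) \<le> q * (d * r) powr \<beta>"
        unfolding q_def using False K(1) by (intro sum_dyadic_powr_le_powr) auto
      hence "C * (\<Sum>k\<le>K. 2 powr (real k * \<beta>)) \<le> C * (q * (d * r) powr \<beta>)"
        using BC(1) by (rule mult_left_mono)
      with K(2) show ?case by simp
    qed
    hence "E \<in> O[at_top](\<lambda>r. B + C * (q * (d * r) powr \<beta>))"
      by (rule bigoI)
    also have "(\<lambda>r. B + C * (q * (d * r) powr \<beta>)) \<in> O[at_top](\<lambda>r. r powr \<beta>)"
    proof (rule sum_in_bigo)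
      \<comment> \<open>The constant is absorbed because \<beta> > 0 in this case.\<close>
      show "(\<lambda>r::real. B) \<in> O[at_top](\<lambda>r. r powr \<beta>)" using False by real_asymp
      have "(\<lambda>r. C * (q * d powr \<beta>) * r powr \<beta>) \<in> O[at_top](\<lambda>r. r powr \<beta>)" by simp
      also have "?this \<longleftrightarrow> (\<lambda>r. C * (q * (d * r) powr \<beta>)) \<in> O[at_top](\<lambda>r. r powr \<beta>)"
        using d by (intro landau_o.big.in_cong eventually_mono[OF eventually_ge_at_top[of 0]])
          (auto simp: powr_mult)
      finally show "(\<lambda>r. C * (q * (d * r) powr \<beta>)) \<in> O[at_top](\<lambda>r. r powr \<beta>)" .
    qed
    finally show ?thesis
      by (intro exI[of _ E] exI[of _ "\<lambda>_. 0"]) (auto simp: E_def \<beta>_def)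
  qed
qed

end
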